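(* Let $q$ be a prime power, let $1\le k\le n\le m$ be integers and $\ell\ge1$. Let $(\alpha_1,\dots,\alpha_n)$ be uniformly distributed over the set of all vectors in $\mathbb{F}_{q^m}^n$ whose coordinates are linearly independent over $\mathbb{F}_q$. Then with probability at least $1-3k\,q^{\,nk\cdot\min\{\ell,k\}+k-m}$, the Gabidulin code $\mathcal{G}_{n,k}(\alpha_1,\dots,\alpha_n)$ over $\mathbb{F}_{q^m}$ is $\mathrm{GKP}(\ell)$.
   Context: $\mathcal{G}_{n,k}(\alpha_1,\dots,\alpha_n)$ is the $[n,k]_{\mathbb{F}_{q^m}}$ code with generator matrix $(\alpha_j^{q^{i-1}})_{i\in[k],j\in[n]}$, i.e. $\{(f(\alpha_1),\dots,f(\alpha_n)): f=\sum_{i=1}^k c_iX^{q^{i-1}}, c_i\in\mathbb{F}_{q^m}\}$. A kernel pattern is a tuple $(V_1,\dots,V_k)$ of $\mathbb{F}_q$-subspaces of $\mathbb{F}_q^n$; it is generic if $\dim(\bigcap_{i\in\Omega}V_i)\le k-|\Omega|$ for all nonempty $\Omega\subseteq[k]$, and has order $\ell$ if exactly $\ell$ distinct nonzero subspaces occur among the $V_i$. A code with generator matrix $G$ attains it if for full-rank $A_i\in\mathbb{F}_q^{n\times\dim V_i}$ with $\mathbb{F}_q$-column span $V_i$ there is an invertible $M$ with rows $\bm{m}_i$ satisfying $\bm{m}_iGA_i=0$ for all $i$. A code is MRD if every nonzero codeword $\bm{v}$ has $\dim_{\mathbb{F}_q}\mathrm{span}_{\mathbb{F}_q}\{v_1,\dots,v_n\}\ge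 n-k+1$, and is $\mathrm{GKP}(\ell)$ if it is MRD and attains all generic kernel patterns of order at most $\ell$. *)

theory Defs
  imports "HOL-Analysis.Analysis"
begin

text \<open>Setting. The field F_q is a finite field type 'b (q = CARD('b)); the field F_{q^m}
  is a finite field type 'a together with an embedding emb : 'b -> 'a (a ring homomorphism,
  hence injective). F_{q^m} is an F_q-vector space via the scalar multiplication
  (c, x) |-> emb c * x. The length n is the cardinality of a finite index type 'n.
  Indices i of the k rows are 0-based naturals i < k.\<close>

definition field_embedding :: "('b::field \<Rightarrow> 'a::field) \<Rightarrow> bool" where
  "field_embedding emb \<longleftrightarrow> emb 1 = 1 \<and> (\<forall>x y. emb (x + y) = emb x + emb y)
     \<and> (\<forall>x y. emb (x * y) = emb x * emb y)"

definition fq_scale :: "('b::field \<Rightarrow> 'a::field) \<Rightarrow> 'b \<Rightarrow> 'a \<Rightarrow> 'a" where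
  "fq_scale emb c x = emb c * x"

definition fq_dim :: "('b::field \<Rightarrow> 'a::field) \<Rightarrow> 'a set \<Rightarrow> nat" where
  "fq_dim emb S = vector_space.dim (fq_scale emb) S"

definition fq_lin_indep_coords :: "('b::field \<Rightarrow> 'a::field) \<Rightarrow> 'a^'n \<Rightarrow> bool" where
  "fq_lin_indep_coords emb \<alpha> \<longleftrightarrow> inj (\<lambda>j. \<alpha> $ j) \<and>
     \<not> module.dependent (fq_scale emb) (range (\<lambda>j. \<alpha> $ j))"

definition gab_gen :: "nat \<Rightarrow> 'a::field^'n \<Rightarrow> nat \<Rightarrow> 'n \<Rightarrow> 'a" where
  "gab_gen q \<alpha> i j = (\<alpha> $ j) ^ (q ^ i)"

definition gabidulin_code :: "nat \<Rightarrow> nat \<Rightarrow> 'a::field^'n \<Rightarrow> ('a^'n) set" where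
  "gabidulin_code q k \<alpha> = {v. \<exists>c::nat \<Rightarrow> 'a. v = (\<chi> j. \<Sum>i<k. c i * gab_gen q \<alpha> i j)}"

definition is_MRD :: "('b::field \<Rightarrow> 'a::field) \<Rightarrow> nat \<Rightarrow> ('a^'n) set \<Rightarrow> bool" where
  "is_MRD emb k C \<longleftrightarrow> (\<forall>v\<in>C. v \<noteq> 0 \<longrightarrow> fq_dim emb (range (\<lambda>j. v $ j)) \<ge> CARD('n) - k + 1)"

definition kernel_pattern :: "nat \<Rightarrow> (nat \<Rightarrow> ('b::field^'n) set) \<Rightarrow> bool" where
  "kernel_pattern k V \<longleftrightarrow> (\<forall>i<k. vec.subspace (V i))"

definition generic_kp :: "nat \<Rightarrow> (nat \<Rightarrow> ('b::field^'n) set) \<Rightarrow> bool" where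
  "generic_kp k V \<longleftrightarrow> (\<forall>\<Omega>. \<Omega> \<subseteq> {..<k} \<and> \<Omega> \<noteq> {} \<longrightarrow>
      vec.dim (\<Inter>i\<in>\<Omega>. V i) \<le> k - card \<Omega>)"

definition kp_order :: "nat \<Rightarrow> (nat \<Rightarrow> ('b::field^'n) set) \<Rightarrow> nat" where
  "kp_order k V = card {V i | i. i < k \<and> V i \<noteq> {0}}"

text \<open>A_i is given by its list of columns cs i; full rank with column span V i.\<close>
definition full_rank_basis_matrix :: "('b::field^'n) set \<Rightarrow> ('b^'n) list \<Rightarrow> bool" where
  "full_rank_basis_matrix W cs \<longleftrightarrow> length cs = vec.dim W \<and> distinct cs \<and>
     vec.independent (set cs) \<and> vec.span (set cs) = W"

definition invertible_sq :: "nat \<Rightarrow> (nat \<Rightarrow> nat \<Rightarrow> 'a::field) \<Rightarrow> bool" where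
  "invertible_sq k M \<longleftrightarrow> (\<exists>N. \<forall>i<k. \<forall>j<k.
      (\<Sum>r<k. M i r * N r j) = (if i = j then 1 else 0) \<and>
      (\<Sum>r<k. N i r * M r j) = (if i = j then 1 else 0))"

definition attains :: "('b::field \<Rightarrow> 'a::field) \<Rightarrow> nat \<Rightarrow> (nat \<Rightarrow> 'n \<Rightarrow> 'a)
    \<Rightarrow> (nat \<Rightarrow> ('b^'n) set) \<Rightarrow> bool" where
  "attains emb k G V \<longleftrightarrow> (\<forall>A. (\<forall>i<k. full_rank_basis_matrix (V i) (A i)) \<longrightarrow>
     (\<exists>M. invertible_sq k M \<and> (\<forall>i<k. \<forall>c\<in>set (A i).
         (\<Sum>j\<in>UNIV. (\<Sum>r<k. M i r * G r j) * emb (c $ j)) = 0)))"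

definition is_GKP :: "('b::field \<Rightarrow> 'a::field) \<Rightarrow> nat \<Rightarrow> nat \<Rightarrow> nat \<Rightarrow> 'a^'n \<Rightarrow> bool" where
  "is_GKP emb q k l \<alpha> \<longleftrightarrow> is_MRD emb k (gabidulin_code q k \<alpha>) \<and>
     (\<forall>V. kernel_pattern k V \<and> generic_kp k V \<and> kp_order k V \<le> l \<longrightarrow>
        attains emb k (gab_gen q \<alpha>) V)"

end

theory Submission
  imports Defs "Jordan_Normal_Form.Determinant"
begin

text \<open>If every V i has dimension k - 1, then attaining the pattern means that the minimal q-polynomials of
  the spaces \<alpha>(V i) are linearly independent. This is a polynomial condition on \<alpha> of degree at most
  k (1 + q + ... + q^(k-1)), so as soon as it holds at one point of F_(q^m)^n, it fails for few points
  on each line through that point, and hence for few points altogether. A smaller V i is enlarged in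
  auxiliary coordinates, which are then frozen at values for which a good point exists.

  One good point is found by an induction modelled on Lovett's proof of the GM-MDS conjecture: letting
  \<alpha> tend to infinity in a direction \<mu> replaces V i by its intersection with the kernel of \<mu> and lowers
  the admissible q-degree of the polynomials attached to those V i that are not contained in it.

  Finally, a generic pattern of order at most l is determined by min l k blocks of k vectors in F_q^n,
  which gives the union bound, and linear independence of the coordinates alone implies MRD.\<close>

section \<open>Polynomial families of linear systems\<close>

text \<open>Over a finite field there is neither a generic point nor a limit, so both are replaced
  by counting: a family of linear systems with coefficients polynomial in t that is onto for one t
  fails to be onto for at most as many t as a determinant has roots. A limit is then the value at t
  = 0 of such a family, and two conditions are met at once by avoiding the bad parameters of both on
  a common line. Being onto, rather than the nonvanishing of one particular determinant, is the
  working notion because it needs no bases of the spaces and tolerates redundant vectors. The price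
  is a lower bound on q^m of order k^2 q^k. It costs nothing, because for smaller fields the
  asserted probability bound is at most 0. In the exponent n k min(l,k) + k - m the first term
  counts the codes of patterns, and q^k / q^m is, up to a factor of order k, the share of bad points
  for one pattern.\<close>

lemma permutes_lt: "p permutes {0..<n::nat} \<Longrightarrow> i < n \<Longrightarrow> p i < n"
  using permutes_in_image[of p "{0..<n}" i] by auto

text \<open>Each factor of a Leibniz term comes from a different row, so the determinant has degree
  at most \<open>sum d R\<close>. It equals 1 at \<open>t0\<close>, hence is not the zero
  polynomial, and every t with an unsolvable right-hand side is one of its roots.\<close>

lemma card_singular_poly_system:
  fixes c :: "'r \<Rightarrow> 'r \<Rightarrow> 'a::field poly"
  assumes fin: "finite R"
    and deg: "\<And>r s. r \<in> R \<Longrightarrow> s \<in> R \<Longrightarrow> degree (c r s) \<le> d r"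
    and t0: "\<And>r s. r \<in> R \<Longrightarrow> s \<in> R \<Longrightarrow> poly (c r s) t0 = (if r = s then 1 else 0)"
  shows "finite {t. \<not> (\<forall>y. \<exists>x. \<forall>r\<in>R. (\<Sum>s\<in>R. poly (c r s) t * x s) = y r)}" (is "finite ?B")
    and "card {t. \<not> (\<forall>y. \<exists>x. \<forall>r\<in>R. (\<Sum>s\<in>R. poly (c r s) t * x s) = y r)} \<le> sum d R"
proof -
  define n where "n = card R"
  obtain g where g: "bij_betw g {0..<n} R"
    using ex_bij_betw_nat_finite[OF fin] n_def by auto
  have gR: "g i \<in> R" if "i < n" for i using g that by (auto simp: bij_betw_def)
  define A where "A = Matrix.mat n n (\<lambda>(i,j). c (g i) (g j))"
  define At where "At = (\<lambda>t. Matrix.mat n n (\<lambda>(i,j). poly (c (g i) (g j)) t))"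
  define P where "P = Determinant.det A"
  have A: "A \<in> carrier_mat n n" and At: "At t \<in> carrier_mat n n" for t
    by (auto simp: A_def At_def)
  have P_eq: "P = (\<Sum>p\<in>{p. p permutes {0..<n}}. signof p * (\<Prod>i = 0..<n. c (g i) (g (p i))))"
    unfolding P_def det_def'[OF A]
    by (intro sum.cong refl arg_cong2[where f="(*)"] prod.cong) (auto simp: A_def permutes_lt)
  have polyP: "poly P t = Determinant.det (At t)" for t
  proof -
    have "poly (signof p * (\<Prod>i = 0..<n. c (g i) (g (p i)))) t =
       signof p * (\<Prod>i = 0..<n. At t $$ (i, p i))" if "p permutes {0..<n}" for p
      using that by (auto simp: At_def poly_prod sign_def permutes_lt intro!: prod.cong)
    thus ?thesis unfolding P_eq det_def'[OF At] poly_sum by (intro sum.cong) auto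
  qed
  have "At t0 = 1\<^sub>m n"
    using g by (intro eq_matI) (auto simp: At_def t0 gR bij_betw_def inj_on_eq_iff)
  hence "poly P t0 = 1" using polyP by simp
  hence P0: "P \<noteq> 0" by auto
  have degP: "degree P \<le> sum d R" unfolding P_eq
  proof (rule degree_sum_le)
    show "finite {p. p permutes {0..<n}}" by (simp add: finite_permutations)
    fix p assume "p \<in> {p. p permutes {0..<n}}"
    hence p: "p permutes {0..<n}" by simp
    have "degree (signof p * (\<Prod>i = 0..<n. c (g i) (g (p i)))) = degree (\<Prod>i = 0..<n. c (g i) (g (p i)))"
      by (auto simp: sign_def)
    also have "\<dots> \<le> (\<Sum>i = 0..<n. degree (c (g i) (g (p i))))"
      using degree_prod_sum_le[of "{0..<n}" "\<lambda>i. c (g i) (g (p i))"] by (simp add: o_def)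
    also have "\<dots> \<le> (\<Sum>i = 0..<n. d (g i))"
      using p by (intro sum_mono deg gR) (auto simp: permutes_lt)
    also have "\<dots> = sum d R" by (rule sum.reindex_bij_betw[OF g])
    finally show "degree (signof p * (\<Prod>i = 0..<n. c (g i) (g (p i)))) \<le> sum d R" .
  qed
  have sub: "?B \<subseteq> {t. poly P t = 0}"
  proof (rule subsetI, rule ccontr)
    fix t assume tB: "t \<in> ?B" and "t \<notin> {t. poly P t = 0}"
    hence "Determinant.det (At t) \<noteq> 0" using polyP by auto
    from det_non_zero_imp_unit[OF At this, of "()"] obtain B where
      B: "B \<in> carrier_mat n n" and AB: "At t * B = 1\<^sub>m n"
      unfolding Units_def ring_mat_def by auto
    have "\<exists>x. \<forall>r\<in>R. (\<Sum>s\<in>R. poly (c r s) t * x s) = y r" for y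
    proof -
      define g' where "g' = the_inv_into {0..<n} g"
      have g'g: "g' (g i) = i" if "i < n" for i
        using that g unfolding g'_def by (auto simp: bij_betw_def the_inv_into_f_f)
      define x where "x s = (\<Sum>i = 0..<n. B $$ (g' s, i) * y (g i))" for s
      have "(\<Sum>s\<in>R. poly (c r s) t * x s) = y r" if r: "r \<in> R" for r
      proof -
        obtain i where i: "i < n" "r = g i" using r g by (auto simp: bij_betw_def)
        have "(\<Sum>s\<in>R. poly (c r s) t * x s) = (\<Sum>j = 0..<n. poly (c r (g j)) t * x (g j))"
          by (rule sum.reindex_bij_betw[OF g, symmetric])
        also have "\<dots> = (\<Sum>j = 0..<n. \<Sum>l = 0..<n. At t $$ (i,j) * B $$ (j,l) * y (g l))"
          using i by (intro sum.cong) (auto simp: x_def g'g At_def sum_distrib_left mult.assoc)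
        also have "\<dots> = (\<Sum>l = 0..<n. (\<Sum>j = 0..<n. At t $$ (i,j) * B $$ (j,l)) * y (g l))"
          by (subst sum.swap) (simp add: sum_distrib_right)
        also have "\<dots> = (\<Sum>l = 0..<n. (At t * B) $$ (i,l) * y (g l))"
          using i At[of t] B by (intro sum.cong) (auto simp: scalar_prod_def)
        also have "\<dots> = (\<Sum>l = 0..<n. (if l = i then y (g l) else 0))"
          using i by (intro sum.cong) (auto simp: AB)
        also have "\<dots> = y r" using i by simp
        finally show ?thesis .
      qed
      thus ?thesis by blast
    qed
    with tB show False by blast
  qed
  have finr: "finite {t. poly P t = 0}" using poly_roots_finite[OF P0] .
  from finite_subset[OF sub finr] show "finite ?B" .
  have "card ?B \<le> card {t. poly P t = 0}" by (rule card_mono[OF finr sub])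
  also have "\<dots> \<le> degree P" using card_poly_roots_bound[OF P0] .
  also note degP
  finally show "card ?B \<le> sum d R" .
qed

lemma nat_matrix_left_inverse:
  fixes M N :: "nat \<Rightarrow> nat \<Rightarrow> 'a::field"
  assumes "\<And>i j. i < k \<Longrightarrow> j < k \<Longrightarrow> (\<Sum>r<k. M i r * N r j) = (if i = j then 1 else 0)"
    and ij: "i < k" "j < k"
  shows "(\<Sum>r<k. N i r * M r j) = (if i = j then 1 else 0)"
proof -
  define A where "A = Matrix.mat k k (\<lambda>(i,j). M i j)"
  define B where "B = Matrix.mat k k (\<lambda>(i,j). N i j)"
  have A: "A \<in> carrier_mat k k" and B: "B \<in> carrier_mat k k" by (auto simp: A_def B_def)
  have "A * B = 1\<^sub>m k"
    using assms(1) by (intro eq_matI) (auto simp: A_def B_def scalar_prod_def lessThan_atLeast0)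
  from mat_mult_left_right_inverse[OF A B this] have "(B * A) $$ (i,j) = 1\<^sub>m k $$ (i,j)" by simp
  thus ?thesis using ij by (simp add: A_def B_def scalar_prod_def lessThan_atLeast0)
qed

section \<open>Moore systems and their degeneration\<close>

text \<open>The system need not be square, so there is no determinant to start from. Composing it
  with a fixed right inverse at \<open>t0\<close> gives a square system that is the identity at
  \<open>t0\<close>; wherever the composition is onto, so is the original. The right inverse does
  not depend on t, so the row degrees do not grow.\<close>

lemma card_unsolvable_affine_system:
  fixes \<phi> :: "'i \<Rightarrow> 'w \<Rightarrow> nat \<Rightarrow> 'a::field poly"
  assumes fin: "finite I"
    and sol: "\<forall>y. \<exists>x u. \<forall>i\<in>I. \<forall>p<h i. x p + (\<Sum>w\<in>W i. u i w * poly (\<phi> i w p) t0) = y i p"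
    and deg: "\<And>i w p. i \<in> I \<Longrightarrow> w \<in> W i \<Longrightarrow> p < h i \<Longrightarrow> degree (\<phi> i w p) \<le> d i p"
  defines "B \<equiv> {t. \<not> (\<forall>y. \<exists>x u. \<forall>i\<in>I. \<forall>p<h i. x p + (\<Sum>w\<in>W i. u i w * poly (\<phi> i w p) t) = y i p)}"
  shows "finite B" and "card B \<le> (\<Sum>i\<in>I. \<Sum>p<h i. d i p)"
proof -
  define R where "R = Sigma I (\<lambda>i. {..<h i})"
  have finR: "finite R" using fin by (simp add: R_def)
  have "\<exists>xu. \<forall>i\<in>I. \<forall>p<h i. fst xu p + (\<Sum>w\<in>W i. snd xu i w * poly (\<phi> i w p) t0)
      = (if (i,p) = s then 1 else 0)" for s
  proof -
    from spec[OF sol, of "\<lambda>i p. if (i,p) = s then 1 else 0"] obtain x u where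
      "\<forall>i\<in>I. \<forall>p<h i. x p + (\<Sum>w\<in>W i. u i w * poly (\<phi> i w p) t0) = (if (i,p) = s then 1 else 0)"
      by blast
    thus ?thesis by (intro exI[of _ "(x, u)"]) simp
  qed
  from choice[OF allI[OF this]] obtain f where f: "\<forall>s. \<forall>i\<in>I. \<forall>p<h i.
     fst (f s) p + (\<Sum>w\<in>W i. snd (f s) i w * poly (\<phi> i w p) t0) = (if (i,p) = s then 1 else 0)" ..
  define X where "X s = fst (f s)" for s
  define U where "U s = snd (f s)" for s
  have XU: "X s p + (\<Sum>w\<in>W i. U s i w * poly (\<phi> i w p) t0) = (if (i,p) = s then 1 else 0)"
    if "i \<in> I" "p < h i" for s i p
    unfolding X_def U_def using f that by blast
  define c where "c r s = [:X s (snd r):] + (\<Sum>w\<in>W (fst r). Polynomial.smult (U s (fst r) w) (\<phi> (fst r) w (snd r)))" for r s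
  define C where "C = {t. \<not> (\<forall>y. \<exists>x. \<forall>r\<in>R. (\<Sum>s\<in>R. poly (c r s) t * x s) = y r)}"
  have poly_c: "poly (c r s) t = X s (snd r) + (\<Sum>w\<in>W (fst r). U s (fst r) w * poly (\<phi> (fst r) w (snd r)) t)" for r s t
    by (simp add: c_def poly_sum)
  have c_deg: "degree (c r s) \<le> d (fst r) (snd r)" if "r \<in> R" for r s
  proof -
    have "degree (\<Sum>w\<in>W (fst r). Polynomial.smult (U s (fst r) w) (\<phi> (fst r) w (snd r))) \<le> d (fst r) (snd r)"
    proof (cases "finite (W (fst r))")
      case True
      thus ?thesis using deg that
        by (intro degree_sum_le) (auto simp: R_def intro: order.trans[OF degree_smult_le])
    qed simp
    thus ?thesis unfolding c_def by (intro degree_add_le) auto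
  qed
  have c_t0: "poly (c r s) t0 = (if r = s then 1 else 0)" if "r \<in> R" for r s
    using that XU[of "fst r" "snd r" s] by (auto simp: poly_c R_def)
  have C: "finite C" "card C \<le> (\<Sum>r\<in>R. d (fst r) (snd r))"
    unfolding C_def by (rule card_singular_poly_system[OF finR c_deg c_t0]; assumption)+
  have "B \<subseteq> C"
  proof (rule subsetI, rule ccontr)
    fix t assume tB: "t \<in> B" and "t \<notin> C"
    have "\<exists>x u. \<forall>i\<in>I. \<forall>p<h i. x p + (\<Sum>w\<in>W i. u i w * poly (\<phi> i w p) t) = y i p" for y
    proof -
      from \<open>t \<notin> C\<close> have "\<forall>y. \<exists>x. \<forall>r\<in>R. (\<Sum>s\<in>R. poly (c r s) t * x s) = y r"
        by (simp add: C_def)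
      from spec[OF this, of "\<lambda>r. y (fst r) (snd r)"] obtain z where
        z: "\<And>r. r \<in> R \<Longrightarrow> (\<Sum>s\<in>R. poly (c r s) t * z s) = y (fst r) (snd r)" by blast
      define x where "x p = (\<Sum>s\<in>R. X s p * z s)" for p
      define u where "u i w = (\<Sum>s\<in>R. U s i w * z s)" for i w
      have "x p + (\<Sum>w\<in>W i. u i w * poly (\<phi> i w p) t) = y i p" if "i \<in> I" "p < h i" for i p
      proof -
        have "(\<Sum>w\<in>W i. u i w * poly (\<phi> i w p) t) = (\<Sum>s\<in>R. (\<Sum>w\<in>W i. U s i w * poly (\<phi> i w p) t) * z s)"
          by (simp add: u_def sum_distrib_right sum_distrib_left sum.swap[of _ R] mult_ac)
        hence "x p + (\<Sum>w\<in>W i. u i w * poly (\<phi> i w p) t) = (\<Sum>s\<in>R. poly (c (i,p) s) t * z s)"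
          by (simp add: x_def poly_c distrib_right sum.distrib)
        thus ?thesis using z[of "(i,p)"] that by (simp add: R_def)
      qed
      thus ?thesis by blast
    qed
    with tB show False unfolding B_def by blast
  qed
  from finite_subset[OF this C(1)] show "finite B" .
  have "card B \<le> card C" by (rule card_mono[OF C(1) \<open>B \<subseteq> C\<close>])
  also note C(2)
  also have "(\<Sum>r\<in>R. d (fst r) (snd r)) = (\<Sum>i\<in>I. \<Sum>p<h i. d i p)"
    unfolding R_def by (subst sum.Sigma) (auto simp: fin split_def)
  finally show "card B \<le> (\<Sum>i\<in>I. \<Sum>p<h i. d i p)" .
qed

definition ev :: "('b::field \<Rightarrow> 'a::field) \<Rightarrow> 'a^'n \<Rightarrow> 'b^'n \<Rightarrow> 'a" where
  "ev emb \<alpha> w = (\<Sum>j\<in>UNIV. emb (vec_nth w j) * vec_nth \<alpha> j)"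

lemma ev_add_smult: "ev emb (\<alpha> + t *s \<beta>) w = ev emb \<alpha> w + t * ev emb \<beta> w"
  by (simp add: ev_def sum.distrib sum_distrib_left algebra_simps)

text \<open>Write U i for the set of vectors whose first h i coordinates are those of a combination of the
  Moore vectors (a, a^q, a^(q^2), ...), a = ev emb \<alpha> w, w in W i. The system says that the diagonal map
  into the direct sum of the quotients by the U i is onto; dually, the spaces of q-polynomials
  of q-degree below h i vanishing on all these a form a direct sum. The bound h i plays the role of a
  multiplicity of the point at infinity.\<close>
definition jointly_solvable :: "('b::field \<Rightarrow> 'a::field) \<Rightarrow> nat \<Rightarrow> 'i set \<Rightarrow> ('i \<Rightarrow> ('b^'n) set)
    \<Rightarrow> ('i \<Rightarrow> nat) \<Rightarrow> 'a^'n \<Rightarrow> bool" where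
  "jointly_solvable emb q I W h \<alpha> \<longleftrightarrow>
     (\<forall>y. \<exists>x u. \<forall>i\<in>I. \<forall>p<h i. x p + (\<Sum>w\<in>W i. u i w * ev emb \<alpha> w ^ (q ^ p)) = y i p)"

lemma degree_linear_power_le: "degree ([:a, b:] ^ n :: 'a::comm_semiring_1 poly) \<le> n"
  using degree_power_le[of "[:a, b:]" n] degree_pCons_le[of a "[:b:]"]
  by (metis degree_pCons_0 le_trans mult.commute mult_le_mono2 nat_mult_1_right One_nat_def)

text \<open>On a line every coefficient in row (i, p) is the q^p-th power of a linear polynomial in
  t; the bound adds up these row degrees.\<close>

lemma card_unsolvable_on_line:
  assumes "finite I" and "jointly_solvable emb q I W h \<alpha>"
  shows "card {t. \<not> jointly_solvable emb q I W h (\<alpha> + t *s \<beta>)} \<le> (\<Sum>i\<in>I. \<Sum>p<h i. q ^ p)"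
proof -
  define \<phi> where "\<phi> i w p = [:ev emb \<alpha> w, ev emb \<beta> w:] ^ (q ^ p)" for i :: 'a and w p
  have poly: "poly (\<phi> i w p) t = ev emb (\<alpha> + t *s \<beta>) w ^ (q ^ p)" for i w p t
    by (simp add: \<phi>_def ev_add_smult)
  have sol: "\<forall>y. \<exists>x u. \<forall>i\<in>I. \<forall>p<h i. x p + (\<Sum>w\<in>W i. u i w * poly (\<phi> i w p) 0) = y i p"
    using assms(2) by (simp add: poly jointly_solvable_def)
  have deg: "degree (\<phi> i w p) \<le> q ^ p" for i w p
    by (simp add: \<phi>_def degree_linear_power_le)
  show ?thesis
    using card_unsolvable_affine_system(2)[OF assms(1) sol, of "\<lambda>i p. q ^ p", OF deg]
    by (simp add: jointly_solvable_def poly)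
qed

text \<open>Put \<alpha> + z^-1 \<mu> and let z tend to 0: after scaling by z^(q^(h-1)), the Moore vector of w outside H
  tends to the last unit vector among the first h, so it only lowers h by one in the limit. The
  system is polynomial in z and solvable at z = 0, hence solvable at some z distinct from 0.\<close>
lemma jointly_solvable_lift_hyperplane:
  fixes W :: "'i \<Rightarrow> ('b::field^'n) set" and \<alpha> :: "'a::{finite,field}^'n"
  assumes fin: "finite I" and q: "2 \<le> q"
    and HW: "\<And>i w. i \<in> I \<Longrightarrow> w \<in> W i \<Longrightarrow> w \<in> H \<Longrightarrow> ev emb \<mu> w = 0"
    and w0: "\<And>i. i \<in> I \<Longrightarrow> \<not> W i \<subseteq> H \<Longrightarrow> \<exists>w\<in>W i. w \<notin> H \<and> ev emb \<mu> w = 1"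
    and finW: "\<And>i. i \<in> I \<Longrightarrow> finite (W i)"
    and hpos: "\<And>i. i \<in> I \<Longrightarrow> \<not> W i \<subseteq> H \<Longrightarrow> 1 \<le> h i"
    and sol: "jointly_solvable emb q I (\<lambda>i. W i \<inter> H) (\<lambda>i. if W i \<subseteq> H then h i else h i - 1) \<alpha>"
    and Q: "(\<Sum>i\<in>I. h i * q ^ (h i - 1)) + 1 < CARD('a)"
  shows "\<exists>s. jointly_solvable emb q I W h (\<alpha> + s *s \<mu>)"
proof -
  define v where "v i = (SOME w. w \<in> W i \<and> w \<notin> H \<and> ev emb \<mu> w = 1)" for i
  have v: "v i \<in> W i" "v i \<notin> H" "ev emb \<mu> (v i) = 1" if "i \<in> I" "\<not> W i \<subseteq> H" for i
    using someI_ex[OF w0[OF that, unfolded Bex_def]] by (auto simp: v_def)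
  define N where "N i = q ^ (h i - 1)" for i
  \<comment> \<open>For \<open>v i\<close> this is z^(N i) (\<open>ev emb \<alpha> (v i)\<close> +
    1/z)^(q^p) written without denominators. At z = 0 only the row p = h i - 1 survives, where q^p =
    N i. All other vectors outside H are given 0: ignoring them only makes the system harder to
    solve.\<close>
  define \<phi> where "\<phi> i w p = (if w \<in> H then [:ev emb \<alpha> w ^ (q ^ p):]
     else if w = v i then [:0, 1:] ^ (N i - q ^ p) * [:1, ev emb \<alpha> w:] ^ (q ^ p) else 0)" for i w p
  have qmono: "q ^ p < N i" if "p < h i - 1" for i p
    using that q by (simp add: N_def)
  have qle: "q ^ p \<le> N i" if "p < h i" for i p
    unfolding N_def using that q by (intro power_increasing) auto
  have \<phi>0: "poly (\<phi> i (v i) p) 0 = (if p = h i - 1 then 1 else 0)"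
    if "i \<in> I" "\<not> W i \<subseteq> H" "p < h i" for i p
    using v[OF that(1,2)] qmono[of p i] that(3) by (auto simp: \<phi>_def N_def)
  have split: "(\<Sum>w\<in>W i. u w * poly (\<phi> i w p) t) = (\<Sum>w\<in>W i \<inter> H. u w * ev emb \<alpha> w ^ (q ^ p)) +
     (if W i \<subseteq> H then 0 else u (v i) * poly (\<phi> i (v i) p) t)" if i: "i \<in> I" for i p t u
  proof -
    have "(\<Sum>w\<in>W i. u w * poly (\<phi> i w p) t) =
       (\<Sum>w\<in>W i \<inter> H. u w * poly (\<phi> i w p) t) + (\<Sum>w\<in>W i - H. u w * poly (\<phi> i w p) t)"
      using finW[OF i] by (subst sum.Int_Diff[of _ _ H]) auto
    also have "(\<Sum>w\<in>W i \<inter> H. u w * poly (\<phi> i w p) t) = (\<Sum>w\<in>W i \<inter> H. u w * ev emb \<alpha> w ^ (q ^ p))"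
      by (intro sum.cong) (auto simp: \<phi>_def)
    also have "(\<Sum>w\<in>W i - H. u w * poly (\<phi> i w p) t) = (if W i \<subseteq> H then 0 else u (v i) * poly (\<phi> i (v i) p) t)"
    proof (cases "W i \<subseteq> H")
      case False
      have "(\<Sum>w\<in>W i - H. u w * poly (\<phi> i w p) t) = (\<Sum>w\<in>{v i}. u w * poly (\<phi> i w p) t)"
        using v[OF i False] finW[OF i] by (intro sum.mono_neutral_right) (auto simp: \<phi>_def)
      with False show ?thesis by simp
    qed (simp add: Diff_eq_empty_iff[THEN iffD2])
    finally show ?thesis .
  qed
  have sol0: "\<exists>x u. \<forall>i\<in>I. \<forall>p<h i. x p + (\<Sum>w\<in>W i. u i w * poly (\<phi> i w p) 0) = y i p" for y
  proof -
    from spec[OF sol[unfolded jointly_solvable_def], of y] obtain x u where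
      "\<forall>i\<in>I. \<forall>p<(if W i \<subseteq> H then h i else h i - 1).
        x p + (\<Sum>w\<in>W i \<inter> H. u i w * ev emb \<alpha> w ^ (q ^ p)) = y i p"
      by blast
    hence xu: "x p + (\<Sum>w\<in>W i \<inter> H. u i w * ev emb \<alpha> w ^ (q ^ p)) = y i p"
      if "i \<in> I" "p < (if W i \<subseteq> H then h i else h i - 1)" for i p
      using that by blast
    \<comment> \<open>The coefficient of \<open>v i\<close> is chosen to satisfy the one equation p
      = h i - 1 that the reduced system lacks.\<close>
    define u' where "u' i w = (if w \<in> H then u i w else
       y i (h i - 1) - x (h i - 1) - (\<Sum>w\<in>W i \<inter> H. u i w * ev emb \<alpha> w ^ (q ^ (h i - 1))))" for i w
    have u'H: "(\<Sum>w\<in>W i \<inter> H. u' i w * ev emb \<alpha> w ^ (q ^ p)) = (\<Sum>w\<in>W i \<inter> H. u i w * ev emb \<alpha> w ^ (q ^ p))" for i p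
      by (intro sum.cong) (auto simp: u'_def)
    have "x p + (\<Sum>w\<in>W i. u' i w * poly (\<phi> i w p) 0) = y i p" if "i \<in> I" "p < h i" for i p
    proof (cases "W i \<subseteq> H")
      case True
      thus ?thesis using xu[of i p] that by (simp add: split u'H)
    next
      case False
      thus ?thesis using xu[of i p] that v[OF that(1) False]
        by (cases "p = h i - 1") (auto simp: split u'H \<phi>0, simp add: u'_def)
    qed
    thus ?thesis by blast
  qed
  have deg: "degree (\<phi> i w p) \<le> N i" if "p < h i" for i w p
  proof -
    have "degree ([:0, 1:] ^ (N i - q ^ p) * [:1, ev emb \<alpha> w:] ^ (q ^ p)) \<le> (N i - q ^ p) + q ^ p"
      using degree_mult_le[of "[:0, 1:] ^ (N i - q ^ p)" "[:1, ev emb \<alpha> w:] ^ (q ^ p)"]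
        degree_linear_power_le[of 0 1 "N i - q ^ p"] degree_linear_power_le[of 1 "ev emb \<alpha> w" "q ^ p"]
      by (meson add_mono order.trans)
    thus ?thesis using qle[OF that] by (auto simp: \<phi>_def)
  qed
  define B where "B = {t. \<not> (\<forall>y. \<exists>x u. \<forall>i\<in>I. \<forall>p<h i. x p + (\<Sum>w\<in>W i. u i w * poly (\<phi> i w p) t) = y i p)}"
  have "finite B" "card B \<le> (\<Sum>i\<in>I. \<Sum>p<h i. N i)"
    unfolding B_def by (rule card_unsolvable_affine_system[OF fin allI[OF sol0] deg]; assumption)+
  \<comment> \<open>The h i rows of member i cost N i parameters each; the extra 1 in
    \<open>Q\<close> excludes z = 0.\<close>
  hence "card (insert 0 B) < CARD('a)" using Q card_insert_le_m1[of "Suc (card B)" B 0]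
    by (simp add: N_def)
  then obtain z where z: "z \<noteq> 0" "z \<notin> B"
    by (metis card_mono finite insertCI linorder_not_less subsetI)
  have "\<exists>x u. \<forall>i\<in>I. \<forall>p<h i. x p + (\<Sum>w\<in>W i. u i w * ev emb (\<alpha> + (1/z) *s \<mu>) w ^ (q ^ p)) = y i p" for y
  proof -
    obtain x u where xu: "\<And>i p. i \<in> I \<Longrightarrow> p < h i \<Longrightarrow> x p + (\<Sum>w\<in>W i. u i w * poly (\<phi> i w p) z) = y i p"
      using z unfolding B_def by blast
    \<comment> \<open>Undoing the scaling moves z^(N i) into the coefficient of
      \<open>v i\<close>.\<close>
    define u' where "u' i w = (if w \<in> H then u i w else if w = v i then u i w * z ^ N i else 0)" for i w
    have "u' i w * ev emb (\<alpha> + (1/z) *s \<mu>) w ^ (q ^ p) = u i w * poly (\<phi> i w p) z"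
      if "i \<in> I" "p < h i" "w \<in> W i" for i p w
    proof -
      have "z ^ N i * (ev emb \<alpha> w + 1 / z) ^ (q ^ p) = z ^ (N i - q ^ p) * (1 + z * ev emb \<alpha> w) ^ (q ^ p)"
      proof -
        have "z ^ N i = z ^ (N i - q ^ p) * z ^ (q ^ p)"
          using qle[OF that(2)] by (simp flip: power_add)
        hence "z ^ N i * (ev emb \<alpha> w + 1 / z) ^ (q ^ p) = z ^ (N i - q ^ p) * (z * (ev emb \<alpha> w + 1 / z)) ^ (q ^ p)"
          by (simp add: power_mult_distrib)
        also have "z * (ev emb \<alpha> w + 1 / z) = 1 + z * ev emb \<alpha> w" using z by (simp add: field_simps)
        finally show ?thesis .
      qed
      moreover have "ev emb \<mu> w = 1" if "w = v i" "w \<notin> H" using v[of i] that \<open>i \<in> I\<close> \<open>w \<in> W i\<close> by auto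
      ultimately show ?thesis using that HW by (auto simp: u'_def \<phi>_def ev_add_smult)
    qed
    hence "x p + (\<Sum>w\<in>W i. u' i w * ev emb (\<alpha> + (1/z) *s \<mu>) w ^ (q ^ p)) = y i p"
      if "i \<in> I" "p < h i" for i p
      using xu[OF that] that by simp
    thus ?thesis by blast
  qed
  thus ?thesis unfolding jointly_solvable_def by blast
qed

section \<open>Hyperplanes over F_q as kernels of functionals\<close>

definition dotp :: "'b::field^'n \<Rightarrow> 'b^'n \<Rightarrow> 'b" where
  "dotp c w = (\<Sum>j\<in>UNIV. vec_nth c j * vec_nth w j)"

lemma dotp_add: "dotp c (v + w) = dotp c v + dotp c w"
  by (simp add: dotp_def algebra_simps sum.distrib)

lemma dotp_scale: "dotp c (a *s w) = a * dotp c w"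
  by (simp add: dotp_def sum_distrib_left algebra_simps)

lemma subspace_dotp_kernel: "vec.subspace {w. dotp c w = 0}"
  by (auto simp: vec.subspace_def dotp_add dotp_scale) (simp add: dotp_def)

lemma dim_Int_dotp_kernel:
  assumes W: "vec.subspace W" and w0: "w0 \<in> W" "dotp c w0 \<noteq> 0"
  shows "vec.dim W = vec.dim (W \<inter> {w. dotp c w = 0}) + 1"
proof -
  let ?K = "W \<inter> {w. dotp c w = 0}"
  have K: "vec.subspace ?K" using W subspace_dotp_kernel by (rule vec.subspace_inter)
  hence sK: "vec.span ?K = ?K" by simp
  have "W = vec.span (insert w0 ?K)"
  proof
    show "W \<subseteq> vec.span (insert w0 ?K)"
    proof
      fix w assume w: "w \<in> W"
      let ?a = "dotp c w / dotp c w0"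
      have "w - ?a *s w0 = w + (- ?a) *s w0" by simp
      hence "dotp c (w - ?a *s w0) = 0" using w0 by (simp only: dotp_add dotp_scale) simp
      moreover have "w - ?a *s w0 \<in> W" using W w w0 by (simp add: vec.subspace_diff vec.subspace_scale)
      ultimately have "w - ?a *s w0 \<in> vec.span ?K" by (simp add: sK)
      thus "w \<in> vec.span (insert w0 ?K)" unfolding vec.span_insert by blast
    qed
    show "vec.span (insert w0 ?K) \<subseteq> W" using W w0 by (intro vec.span_minimal) auto
  qed
  hence "vec.dim W = vec.dim (insert w0 ?K)" by (metis vec.dim_span)
  also have "\<dots> = vec.dim ?K + 1" using w0 by (simp add: vec.dim_insert sK)
  finally show ?thesis .
qed

lemma exists_separating_dotp:
  fixes W :: "('b::field^'n) set"
  assumes W: "vec.subspace W" and x: "x \<notin> W"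
  shows "\<exists>c. (\<forall>w\<in>W. dotp c w = 0) \<and> dotp c x = 1"
proof -
  obtain B where B: "B \<subseteq> W" "vec.independent B" "W \<subseteq> vec.span B"
    using vec.maximal_independent_subset by blast
  have "vec.span B \<subseteq> W" using B W by (simp add: vec.span_minimal)
  hence "vec.independent (insert x B)" using B x by (subst vec.independent_insert) auto
  then obtain f :: "'b^'n \<Rightarrow> 'b^'n" where f: "Vector_Spaces.linear (*s) (*s) f"
    "\<forall>v\<in>insert x B. f v = (if v = x then 1 else 0)"
    using vec.linear_independent_extend[of "insert x B" "\<lambda>v. if v = x then 1 else 0"] by blast
  \<comment> \<open>\<open>f x\<close> is the all-ones vector, so any coordinate of \<open>f\<close>
    is a functional with value 1 at \<open>x\<close>.\<close>
  define j :: 'n where "j = undefined"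
  define c where "c = vec_nth (matrix f) j"
  have c: "dotp c w = vec_nth (f w) j" for w
    by (subst matrix_works[OF f(1), symmetric]) (simp add: c_def dotp_def matrix_vector_mult_def)
  interpret f: Vector_Spaces.linear "(*s)" "(*s)" f by (rule f(1))
  have "f w = 0" if "w \<in> W" for w
  proof -
    have "w \<in> vec.span B" using that B by auto
    moreover have "f v = 0" if "v \<in> B" for v using f(2) that x B by auto
    ultimately show ?thesis
    proof (induction rule: vec.span_induct)
      case base
      show ?case by (auto simp: vec.subspace_def f.scale f.add f.zero)
    qed auto
  qed
  hence "\<forall>w\<in>W. dotp c w = 0" by (simp add: c)
  moreover have "dotp c x = 1" using f(2) by (simp add: c)
  ultimately show ?thesis by blast
qed

lemma field_embedding_zero: "field_embedding emb \<Longrightarrow> emb 0 = 0"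
  unfolding field_embedding_def by (metis add_cancel_right_right)

lemma field_embedding_sum: "field_embedding emb \<Longrightarrow> emb (sum f A) = (\<Sum>x\<in>A. emb (f x))"
  by (induction A rule: infinite_finite_induct) (auto simp: field_embedding_zero, simp add: field_embedding_def)

lemma ev_embedded:
  assumes "field_embedding emb"
  shows "ev emb (\<chi> j. emb (vec_nth c j)) w = emb (dotp c w)"
  using assms by (simp add: ev_def dotp_def field_embedding_sum)
    (simp add: field_embedding_def mult.commute)

text \<open>Each system is solvable at one end of the line through \<alpha> and \<beta>, so each has
  few bad parameters on it. Those of the second system are counted from \<beta>, hence the
  substitution of 1 - t for t.\<close>

lemma common_solvable_point:
  fixes \<alpha> \<beta> :: "'a::{finite,field}^'n"
  assumes fin: "finite I" "finite I'"
    and \<alpha>: "jointly_solvable emb q I W h \<alpha>" and \<beta>: "jointly_solvable emb q I' W' h' \<beta>"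
    and Q: "(\<Sum>i\<in>I. \<Sum>p<h i. q ^ p) + (\<Sum>i\<in>I'. \<Sum>p<h' i. q ^ p) < CARD('a)"
  shows "\<exists>\<gamma>. jointly_solvable emb q I W h \<gamma> \<and> jointly_solvable emb q I' W' h' \<gamma>"
proof -
  let ?A = "{t. \<not> jointly_solvable emb q I W h (\<alpha> + t *s (\<beta> - \<alpha>))}"
  let ?B = "{t. \<not> jointly_solvable emb q I' W' h' (\<beta> + t *s (\<alpha> - \<beta>))}"
  have "card (?A \<union> (\<lambda>t. 1 - t) ` ?B) \<le> card ?A + card ?B"
    by (rule order.trans[OF card_Un_le]) (simp add: card_image_le)
  also have "\<dots> < CARD('a)"
    using card_unsolvable_on_line[OF fin(1) \<alpha>, of "\<beta> - \<alpha>"]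
      card_unsolvable_on_line[OF fin(2) \<beta>, of "\<alpha> - \<beta>"] Q by linarith
  finally have "?A \<union> (\<lambda>t. 1 - t) ` ?B \<noteq> UNIV" by auto
  then obtain t where t: "t \<notin> ?A" "t \<notin> (\<lambda>t. 1 - t) ` ?B" by blast
  have "1 - t \<notin> ?B"
  proof
    assume "1 - t \<in> ?B"
    from imageI[OF this, of "\<lambda>t. 1 - t"] have "t \<in> (\<lambda>t. 1 - t) ` ?B" by simp
    with t(2) show False by contradiction
  qed
  moreover have "\<beta> + (1 - t) *s (\<alpha> - \<beta>) = \<alpha> + t *s (\<beta> - \<alpha>)"
    by (vector algebra_simps)
  ultimately show ?thesis using t(1) by auto
qed

text \<open>The first sum is the cost of a line, the second that of a passage to infinity. A common
  bound lets one field-size hypothesis serve a whole induction.\<close>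

lemma sum_powers_le:
  fixes q :: nat
  assumes "card I \<le> m" "\<And>i. i \<in> I \<Longrightarrow> h i \<le> k" "1 \<le> q"
  shows "(\<Sum>i\<in>I. \<Sum>p<h i. q ^ p) \<le> m * k * q ^ k"
    and "(\<Sum>i\<in>I. h i * q ^ (h i - 1)) \<le> m * k * q ^ k"
proof -
  have "(\<Sum>p<h i. q ^ p) \<le> k * q ^ k" if "i \<in> I" for i
  proof -
    have "(\<Sum>p<h i. q ^ p) \<le> (\<Sum>p<h i. q ^ k)"
      using assms(2)[OF that] assms(3) by (intro sum_mono power_increasing) auto
    also have "\<dots> \<le> k * q ^ k" using assms(2)[OF that] by simp
    finally show ?thesis .
  qed
  hence "(\<Sum>i\<in>I. \<Sum>p<h i. q ^ p) \<le> card I * (k * q ^ k)"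
    by (metis (no_types, lifting) sum_bounded_above of_nat_id)
  thus "(\<Sum>i\<in>I. \<Sum>p<h i. q ^ p) \<le> m * k * q ^ k"
    by (rule order.trans) (simp only: mult.assoc mult_le_mono1[OF assms(1)])
  have "h i * q ^ (h i - 1) \<le> k * q ^ k" if "i \<in> I" for i
    using assms(2)[OF that] assms(3) by (intro mult_mono power_increasing) auto
  hence "(\<Sum>i\<in>I. h i * q ^ (h i - 1)) \<le> card I * (k * q ^ k)"
    by (metis (no_types, lifting) sum_bounded_above of_nat_id)
  thus "(\<Sum>i\<in>I. h i * q ^ (h i - 1)) \<le> m * k * q ^ k"
    by (rule order.trans) (simp only: mult.assoc mult_le_mono1[OF assms(1)])
qed

lemma jointly_solvable_lift_dotp:
  fixes W :: "'i \<Rightarrow> ('b::{finite,field}^'n) set" and \<alpha> :: "'a::{finite,field}^'n"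
  assumes fe: "field_embedding emb" and fin: "finite I" and q: "2 \<le> q"
    and W: "\<And>i. i \<in> I \<Longrightarrow> vec.subspace (W i) \<or> W i = {}"
    and hpos: "\<And>i. i \<in> I \<Longrightarrow> vec.dim (W i) \<le> h i"
    and sol: "jointly_solvable emb q I (\<lambda>i. W i \<inter> {w. dotp c w = 0})
       (\<lambda>i. if W i \<subseteq> {w. dotp c w = 0} then h i else h i - 1) \<alpha>"
    and Q: "(\<Sum>i\<in>I. h i * q ^ (h i - 1)) + 1 < CARD('a)"
  shows "\<exists>\<beta>. jointly_solvable emb q I W h \<beta>"
proof -
  let ?\<mu> = "\<chi> j. emb (vec_nth c j)"
  have "\<exists>w\<in>W i. w \<notin> {w. dotp c w = 0} \<and> ev emb ?\<mu> w = 1"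
    if i: "i \<in> I" "\<not> W i \<subseteq> {w. dotp c w = 0}" for i
  proof -
    obtain w where w: "w \<in> W i" "dotp c w \<noteq> 0" using i by auto
    let ?w = "(1 / dotp c w) *s w"
    have "?w \<in> W i" using W[OF i(1)] w by (auto simp: vec.subspace_scale)
    moreover have "dotp c ?w = 1" using w by (simp add: dotp_scale)
    ultimately show ?thesis using fe
      by (intro bexI[of _ ?w]) (auto simp: ev_embedded field_embedding_def)
  qed
  moreover have "ev emb ?\<mu> w = 0" if "w \<in> {w. dotp c w = 0}" for w
    using that fe by (simp add: ev_embedded field_embedding_zero)
  moreover have "1 \<le> h i" if i: "i \<in> I" "\<not> W i \<subseteq> {w. dotp c w = 0}" for i
  proof -
    obtain w where w: "w \<in> W i" "dotp c w \<noteq> 0" using i by auto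
    hence "vec.dim (W i) \<noteq> 0" by (auto simp: dotp_def)
    thus ?thesis using hpos[OF i(1)] by linarith
  qed
  ultimately show ?thesis
    using jointly_solvable_lift_hyperplane[OF fin q _ _ _ _ sol Q, of ?\<mu>] by auto
qed

text \<open>The member {} imposes x = y on the first d coordinates, so this says that the Moore matrix of a
  basis of X is invertible.\<close>
lemma moore_solvable:
  fixes X :: "('b::{finite,field}^'n) set" and emb :: "'b \<Rightarrow> 'a::{finite,field}"
  assumes fe: "field_embedding emb" and q: "2 \<le> q"
    and Q: "2 * d * q ^ d + 1 < CARD('a)"
    and X: "vec.subspace X" and le: "vec.dim X \<le> d"
  shows "\<exists>\<alpha> :: 'a^'n. jointly_solvable emb q UNIV (\<lambda>b. if b then X else {})
           (\<lambda>b. if b then vec.dim X else d) \<alpha>"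
  using X le
proof (induction "vec.dim X" arbitrary: X)
  case 0
  have "jointly_solvable emb q UNIV (\<lambda>b. if b then X else {}) (\<lambda>b. if b then vec.dim X else d) 0"
    unfolding jointly_solvable_def
  proof
    fix y :: "bool \<Rightarrow> nat \<Rightarrow> 'a"
    show "\<exists>x u. \<forall>b\<in>UNIV. \<forall>p<(if b then vec.dim X else d).
       x p + (\<Sum>w\<in>(if b then X else {}). u b w * ev emb 0 w ^ q ^ p) = y b p"
      by (rule exI[of _ "y False"]) (simp add: 0(1)[symmetric])
  qed
  thus ?case by blast
next
  case (Suc e)
  have "\<not> X \<subseteq> {0}" using Suc.hyps(2) by (metis vec.dim_eq_0 nat.distinct(1))
  then obtain x where x: "x \<in> X" "x \<notin> {0}" by blast
  obtain c where c: "dotp c x = 1" using exists_separating_dotp[OF vec.subspace_single_0 x(2)] by blast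
  let ?K = "{w. dotp c w = 0}"
  have dim: "vec.dim X = vec.dim (X \<inter> ?K) + 1"
    using dim_Int_dotp_kernel[OF Suc.prems(1) x(1)] c by simp
  have "e = vec.dim (X \<inter> ?K)" "vec.subspace (X \<inter> ?K)" "vec.dim (X \<inter> ?K) \<le> d"
    using dim Suc vec.subspace_inter[OF Suc.prems(1) subspace_dotp_kernel] by auto
  from Suc.hyps(1)[OF this] obtain \<alpha> :: "'a^'n" where
    "jointly_solvable emb q UNIV (\<lambda>b. if b then X \<inter> ?K else {}) (\<lambda>b. if b then vec.dim (X \<inter> ?K) else d) \<alpha>" by blast
  moreover have "(\<lambda>b. if b then X \<inter> ?K else {}) = (\<lambda>b. (if b then X else {}) \<inter> ?K)" by (simp add: fun_eq_iff)
  \<comment> \<open>The member {} lies in every hyperplane and keeps its bound d, while X loses one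
    dimension and its bound drops by one.\<close>
  moreover have "(\<lambda>b. if b then vec.dim (X \<inter> ?K) else d) =
     (\<lambda>b. if (if b then X else {}) \<subseteq> ?K then (if b then vec.dim X else d) else (if b then vec.dim X else d) - 1)"
    using x c dim by (auto simp: fun_eq_iff)
  ultimately have "jointly_solvable emb q UNIV (\<lambda>b. (if b then X else {}) \<inter> ?K)
    (\<lambda>b. if (if b then X else {}) \<subseteq> ?K then (if b then vec.dim X else d) else (if b then vec.dim X else d) - 1) \<alpha>"
    by simp
  thus ?case
  proof (rule jointly_solvable_lift_dotp[OF fe _ q, rotated 3])
    have "(\<Sum>i\<in>UNIV. (if i then vec.dim X else d) * q ^ ((if i then vec.dim X else d) - 1)) \<le> 2 * d * q ^ d"
      by (rule sum_powers_le(2)) (use Suc.prems q in auto)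
    thus "(\<Sum>i\<in>UNIV. (if i then vec.dim X else d) * q ^ ((if i then vec.dim X else d) - 1)) + 1 < CARD('a)"
      using Q by linarith
  qed (use Suc.prems in auto)
qed

section \<open>Existence of solvable evaluation points\<close>

text \<open>A dimension count for the dual q-polynomials at independent evaluation points: those
  attached to W i form a space of dimension h i - dim W i, and for all i in J they lie among the
  q-polynomials of q-degree below the largest h i that vanish on the intersection. For h i = k and
  dim W i = k - 1 the inequality says that the intersection has dimension at most k - card J, as in
  genericity.\<close>

definition pattern_cond :: "'i set \<Rightarrow> ('i \<Rightarrow> ('b::field^'n) set) \<Rightarrow> ('i \<Rightarrow> nat) \<Rightarrow> bool" where
  "pattern_cond I W h \<longleftrightarrow> (\<forall>J\<subseteq>I. J \<noteq> {} \<longrightarrow>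
     sum h J + vec.dim (\<Inter>i\<in>J. W i) \<le> Max (h ` J) + (\<Sum>i\<in>J. vec.dim (W i)))"

lemma pattern_cond_subset: "pattern_cond I W h \<Longrightarrow> J \<subseteq> I \<Longrightarrow> pattern_cond J W h"
  unfolding pattern_cond_def by blast

lemma pattern_condD:
  "pattern_cond I W h \<Longrightarrow> J \<subseteq> I \<Longrightarrow> J \<noteq> {} \<Longrightarrow>
     sum h J + vec.dim (\<Inter>i\<in>J. W i) \<le> Max (h ` J) + (\<Sum>i\<in>J. vec.dim (W i))"
  unfolding pattern_cond_def by blast

text \<open>Dually, equality for J means that its members leave no room among the q-polynomials
  vanishing on the intersection, so one member with the intersection and the largest bound can stand
  for them all. For T disjoint from J, the condition for j together with T is the condition for the
  union of J and T minus the equality for J.\<close>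

lemma pattern_cond_merge:
  fixes W :: "'i \<Rightarrow> ('b::field^'n) set"
  assumes cond: "pattern_cond I W h" and fin: "finite I" and J: "J \<subseteq> I" "j \<in> J"
    and tight: "Max (h ` J) + (\<Sum>i\<in>J. vec.dim (W i)) \<le> sum h J + vec.dim (\<Inter>i\<in>J. W i)"
  shows "pattern_cond (insert j (I - J)) (W(j := \<Inter>i\<in>J. W i)) (h(j := Max (h ` J)))"
  unfolding pattern_cond_def
proof (intro allI impI)
  let ?W = "W(j := \<Inter>i\<in>J. W i)" and ?h = "h(j := Max (h ` J))"
  fix J' assume J': "J' \<subseteq> insert j (I - J)" "J' \<noteq> {}"
  have finJ: "finite J" using J fin finite_subset by blast
  define T where "T = J' - {j}"
  have T: "T \<subseteq> I" "T \<inter> J = {}" "j \<notin> T" "finite T" using J' J fin by (auto simp: T_def intro: finite_subset)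
  have on_T: "sum ?h T = sum h T" "?h ` T = h ` T" "(\<Inter>i\<in>T. ?W i) = (\<Inter>i\<in>T. W i)"
    "(\<Sum>i\<in>T. vec.dim (?W i)) = (\<Sum>i\<in>T. vec.dim (W i))"
    using T(3) by (auto intro!: sum.cong)
  show "sum ?h J' + vec.dim (\<Inter>i\<in>J'. ?W i) \<le> Max (?h ` J') + (\<Sum>i\<in>J'. vec.dim (?W i))"
  proof (cases "j \<in> J'")
    case False
    hence "J' = T" by (auto simp: T_def)
    thus ?thesis using pattern_condD[OF cond T(1)] J'(2) on_T by simp
  next
    case True
    hence J'T: "J' = insert j T" by (auto simp: T_def)
    have ne: "J \<noteq> {}" using J by auto
    have "sum h (J \<union> T) + vec.dim (\<Inter>i\<in>J \<union> T. W i) \<le> Max (h ` (J \<union> T)) + (\<Sum>i\<in>J \<union> T. vec.dim (W i))"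
      using J T(1) ne by (intro pattern_condD[OF cond]) auto
    moreover have "sum h (J \<union> T) = sum h J + sum h T" "(\<Sum>i\<in>J \<union> T. vec.dim (W i)) = (\<Sum>i\<in>J. vec.dim (W i)) + (\<Sum>i\<in>T. vec.dim (W i))"
      using T finJ by (auto intro!: sum.union_disjoint)
    moreover have "Max (?h ` J') = Max (h ` (J \<union> T))"
    proof (cases "T = {}")
      case False
      have "?h ` J' = insert (Max (h ` J)) (h ` T)" unfolding J'T image_insert on_T(2) by simp
      thus ?thesis using False ne finJ T(4) by (simp add: image_Un Max_Un)
    qed (simp add: J'T)
    moreover have "vec.dim (\<Inter>i\<in>J \<union> T. W i) = vec.dim (\<Inter>i\<in>J'. ?W i)"
      using on_T(3) by (intro arg_cong[where f = vec.dim]) (auto simp: J'T)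
    moreover have "sum ?h J' = Max (h ` J) + sum h T" using on_T(1) T by (simp add: J'T)
    moreover have "(\<Sum>i\<in>J'. vec.dim (?W i)) = vec.dim (\<Inter>i\<in>J. W i) + (\<Sum>i\<in>T. vec.dim (W i))"
      using on_T(4) T by (simp add: J'T)
    ultimately show ?thesis using tight by linarith
  qed
qed

text \<open>For every member not inside K both h i and dim W i drop by exactly one, so the two sums
  change equally and only the maximum can spoil the inequality, by at most one. Proper subfamilies
  with at least two members have that one to spare. For the whole family the maximum is attained at
  \<open>i0\<close>, which lies in K and is not lowered. Singletons satisfy the condition
  trivially.\<close>

lemma pattern_cond_hyperplane:
  fixes W :: "'i \<Rightarrow> ('b::field^'n) set"
  assumes cond: "pattern_cond I W h" and fin: "finite I"
    and W: "\<And>i. i \<in> I \<Longrightarrow> vec.subspace (W i) \<and> vec.dim (W i) \<le> h i"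
    and i0: "i0 \<in> I" "h i0 = Max (h ` I)" "W i0 \<subseteq> {w. dotp c w = 0}"
    and slack: "\<And>J. J \<subseteq> I \<Longrightarrow> 1 < card J \<Longrightarrow> card J < card I \<Longrightarrow>
       sum h J + vec.dim (\<Inter>i\<in>J. W i) < Max (h ` J) + (\<Sum>i\<in>J. vec.dim (W i))"
  defines "K \<equiv> {w. dotp c w = 0}"
  shows "pattern_cond I (\<lambda>i. W i \<inter> K) (\<lambda>i. if W i \<subseteq> K then h i else h i - 1)"
    and "\<And>i. i \<in> I \<Longrightarrow> vec.dim (W i \<inter> K) \<le> (if W i \<subseteq> K then h i else h i - 1)"
proof -
  define e where "e i = (if W i \<subseteq> K then 0 else 1 :: nat)" for i
  let ?h = "\<lambda>i. if W i \<subseteq> K then h i else h i - 1"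
  have dimW: "vec.dim (W i) = vec.dim (W i \<inter> K) + e i" if "i \<in> I" for i
  proof (cases "W i \<subseteq> K")
    case True
    thus ?thesis by (simp add: e_def Int_absorb2)
  next
    case False
    then obtain w where "w \<in> W i" "dotp c w \<noteq> 0" by (auto simp: K_def)
    from dim_Int_dotp_kernel[OF _ this] W[OF that] False show ?thesis by (simp add: e_def K_def)
  qed
  have h: "h i = ?h i + e i" if "i \<in> I" for i
    using dimW[OF that] W[OF that] by (cases "W i \<subseteq> K") (auto simp: e_def)
  show "vec.dim (W i \<inter> K) \<le> ?h i" if "i \<in> I" for i
    using dimW[OF that] W[OF that] h[OF that] by linarith
  show "pattern_cond I (\<lambda>i. W i \<inter> K) ?h"
    unfolding pattern_cond_def
  proof (intro allI impI)
    fix J assume J: "J \<subseteq> I" "J \<noteq> {}"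
    have finJ: "finite J" using J fin finite_subset by blast
    have cJ: "card J > 0" using J finJ by auto
    have sh: "sum h J = sum ?h J + sum e J" and sd: "(\<Sum>i\<in>J. vec.dim (W i)) = (\<Sum>i\<in>J. vec.dim (W i \<inter> K)) + sum e J"
      unfolding sum.distrib[symmetric] using h dimW J by (auto intro!: sum.cong)
    have dI: "vec.dim (\<Inter>i\<in>J. W i \<inter> K) \<le> vec.dim (\<Inter>i\<in>J. W i)"
      by (rule vec.dim_subset) auto
    have M1: "Max (h ` J) \<le> Max (?h ` J) + 1"
    proof (subst Max_le_iff)
      show "\<forall>a\<in>h ` J. a \<le> Max (?h ` J) + 1"
      proof
        fix a assume "a \<in> h ` J"
        then obtain i where i: "i \<in> J" "a = h i" by auto
        have "?h i \<le> Max (?h ` J)" using i finJ by (intro Max_ge) auto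
        thus "a \<le> Max (?h ` J) + 1" using i by (auto split: if_splits)
      qed
    qed (use J finJ in auto)
    consider "card J = 1" | "J = I" | "1 < card J" "card J < card I"
      using cJ J fin psubset_card_mono[of I J] by fastforce
    thus "sum ?h J + vec.dim (\<Inter>i\<in>J. W i \<inter> K) \<le> Max (?h ` J) + (\<Sum>i\<in>J. vec.dim (W i \<inter> K))"
    proof cases
      case 1
      then obtain i where "J = {i}" by (auto simp: card_1_singleton_iff)
      thus ?thesis by (cases "W i \<subseteq> K") simp_all
    next
      case 2
      have "?h i0 \<le> Max (?h ` I)"
        by (rule Max_ge[OF finite_imageI[OF fin] imageI[OF i0(1)]])
      hence "Max (h ` I) \<le> Max (?h ` I)" using i0 by (simp add: K_def)
      thus ?thesis using pattern_condD[OF cond J] sh sd dI 2 by simp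
    next
      case 3
      thus ?thesis using slack[OF J(1) 3] sh sd dI M1 by linarith
    qed
  qed
qed

text \<open>Lovett's induction. A proper subfamily with equality in the condition splits the problem: solve it
  separately and replace it by its intersection. Otherwise intersecting with a hyperplane through a
  member W i0 of maximal h keeps the condition. If W i0 is the whole space X, then every other h i is
  at most dim X, and the Moore matrix of X decouples W i0 from the rest.\<close>
lemma pattern_cond_imp_solvable:
  fixes W :: "'i \<Rightarrow> ('b::{finite,field}^'n) set" and emb :: "'b \<Rightarrow> 'a::{finite,field}"
  assumes fe: "field_embedding emb" and q: "2 \<le> q"
    and Q: "2 * (m * k * q ^ k) + 1 < CARD('a)" and m: "2 \<le> m"
    and "vec.subspace X" "finite I" "card I \<le> m"
    and "\<And>i. i \<in> I \<Longrightarrow> vec.subspace (W i) \<and> W i \<subseteq> X \<and> vec.dim (W i) \<le> h i \<and> h i \<le> k"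
    and "pattern_cond I W h"
  shows "\<exists>\<alpha>::'a^'n. jointly_solvable emb q I W h \<alpha>"
  using assms(5-)
proof (induction "vec.dim X" arbitrary: X I W h rule: less_induct)
  case (less X)
  note IH_dim = less.hyps
  note X = less.prems(1)
  have q1: "1 \<le> q" using q by simp
  \<comment> \<open>Merging shrinks I inside the same X, whereas the hyperplane step keeps I and
    shrinks X; hence the dimension is the outer measure and \<open>card I\<close> the inner
    one.\<close>
  from less.prems(2-) show ?case
  proof (induction "card I" arbitrary: I W h rule: less_induct)
    case (less I)
    note IH = less.hyps and fin = less.prems(1) and cI = less.prems(2) and W = less.prems(3) and cond = less.prems(4)
    \<comment> \<open>The factor 2 in \<open>Q\<close> is spent here, on two systems sharing one
      line; the summand 1 is spent on the passage to infinity.\<close>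
    have common: "\<exists>\<gamma>. jointly_solvable emb q J1 W1 h1 \<gamma> \<and> jointly_solvable emb q J2 W2 h2 \<gamma>"
      if "finite J1" "finite J2" "card J1 \<le> m" "card J2 \<le> m" "\<And>i. i \<in> J1 \<Longrightarrow> h1 i \<le> k"
       "\<And>i. i \<in> J2 \<Longrightarrow> h2 i \<le> k" "jointly_solvable emb q J1 W1 h1 \<alpha>"
       "jointly_solvable emb q J2 W2 h2 \<beta>" for \<alpha> \<beta> :: "'a^'n" and J1 :: "'i set" and J2 :: "'j set" and h1 h2 W1 W2
    proof (rule common_solvable_point[OF that(1,2,7,8)])
      have "(\<Sum>i\<in>J1. \<Sum>p<h1 i. q ^ p) + (\<Sum>i\<in>J2. \<Sum>p<h2 i. q ^ p) \<le> m * k * q ^ k + m * k * q ^ k"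
        by (intro add_mono sum_powers_le(1) that q1)
      thus "(\<Sum>i\<in>J1. \<Sum>p<h1 i. q ^ p) + (\<Sum>i\<in>J2. \<Sum>p<h2 i. q ^ p) < CARD('a)"
        using Q by simp
    qed
    show ?case
    proof (cases "card I \<le> 1")
      case True
      then obtain i where i: "I \<subseteq> {i}" using fin by (metis card_le_Suc0_iff_eq One_nat_def subsetI singletonI empty_iff insertCI)
      have "jointly_solvable emb q I W h 0"
        unfolding jointly_solvable_def
        by (rule allI, rule_tac x = "y i" in exI, rule exI[of _ "\<lambda>i w. 0"]) (use i in auto)
      thus ?thesis by blast
    next
      case c2: False
      hence Ine: "I \<noteq> {}" by auto
      show ?thesis
      proof (cases "\<exists>J\<subseteq>I. 1 < card J \<and> card J < card I \<and>
           Max (h ` J) + (\<Sum>i\<in>J. vec.dim (W i)) \<le> sum h J + vec.dim (\<Inter>i\<in>J. W i)")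
        case True
        then obtain J where J: "J \<subseteq> I" "1 < card J" "card J < card I"
          "Max (h ` J) + (\<Sum>i\<in>J. vec.dim (W i)) \<le> sum h J + vec.dim (\<Inter>i\<in>J. W i)" by blast
        have finJ: "finite J" using J fin finite_subset by blast
        obtain j where j: "j \<in> J" using J(2) by fastforce
        let ?I = "insert j (I - J)" and ?W = "W(j := \<Inter>i\<in>J. W i)" and ?h = "h(j := Max (h ` J))"
        have "card ?I < card I" using J finJ fin j by (simp add: card_Diff_subset)
        have Max_in: "Max (h ` J) \<in> h ` J" using finJ j by (intro Max_in) auto
        have MaxJ: "Max (h ` J) \<le> k" using Max_in W J by auto
        have hj: "h j \<le> Max (h ` J)" using finJ j by auto
        have "vec.subspace (\<Inter>i\<in>J. W i)" using W J by (intro vec.subspace_Inter) auto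
        moreover have sub: "(\<Inter>i\<in>J. W i) \<subseteq> W j" using j by auto
        moreover have "vec.dim (\<Inter>i\<in>J. W i) \<le> Max (h ` J)"
          using vec.dim_subset[OF sub] W[of j] j J hj by (meson order.trans subsetD)
        moreover have "W j \<subseteq> X" using W j J by blast
        ultimately have W'j: "vec.subspace (?W j) \<and> ?W j \<subseteq> X \<and> vec.dim (?W j) \<le> ?h j \<and> ?h j \<le> k"
          using MaxJ by (auto intro: subset_trans)
        have W': "vec.subspace (?W i) \<and> ?W i \<subseteq> X \<and> vec.dim (?W i) \<le> ?h i \<and> ?h i \<le> k" if "i \<in> ?I" for i
        proof (cases "i = j")
          case False
          thus ?thesis using that W[of i] by simp
        qed (use W'j in simp)
        have cI2: "card ?I \<le> m" using cI \<open>card ?I < card I\<close> by linarith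
        have "\<exists>\<alpha>::'a^'n. jointly_solvable emb q ?I ?W ?h \<alpha>"
          by (rule IH[OF \<open>card ?I < card I\<close> _ cI2 W' pattern_cond_merge[OF cond fin J(1) j J(4)]])
            (use fin in simp)
        then obtain \<alpha> :: "'a^'n" where \<alpha>: "jointly_solvable emb q ?I ?W ?h \<alpha>" ..
        have WJ: "vec.subspace (W i) \<and> W i \<subseteq> X \<and> vec.dim (W i) \<le> h i \<and> h i \<le> k" if "i \<in> J" for i
          using W J(1) that by blast
        have cJ: "card J \<le> m" using cI J(3) by linarith
        from IH[OF J(3) finJ cJ WJ pattern_cond_subset[OF cond J(1)]]
        obtain \<beta> :: "'a^'n" where \<beta>: "jointly_solvable emb q J W h \<beta>" by blast
        from common[OF _ finJ cI2 cJ _ _ \<alpha> \<beta>] W' WJ fin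
        obtain \<gamma> :: "'a^'n" where \<gamma>: "jointly_solvable emb q ?I ?W ?h \<gamma>" "jointly_solvable emb q J W h \<gamma>"
          by blast
        have "\<exists>x u. \<forall>i\<in>I. \<forall>p<h i. x p + (\<Sum>w\<in>W i. u i w * ev emb \<gamma> w ^ (q ^ p)) = y i p" for y
        proof -
          from \<gamma>(2)[unfolded jointly_solvable_def, THEN spec[of _ y]] obtain x1 u1 where
            1: "\<forall>i\<in>J. \<forall>p<h i. x1 p + (\<Sum>w\<in>W i. u1 i w * ev emb \<gamma> w ^ (q ^ p)) = y i p" by blast
          \<comment> \<open>The merged member is asked for \<open>x1\<close> instead of
            \<open>y j\<close>. Then \<open>x2\<close> and \<open>x1\<close> differ by a combination
            over the intersection, which every member of J can absorb into its own
            coefficients.\<close>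
          from \<gamma>(1)[unfolded jointly_solvable_def, THEN spec[of _ "y(j := x1)"]] obtain x2 u2 where
            2: "\<forall>i\<in>?I. \<forall>p<?h i. x2 p + (\<Sum>w\<in>?W i. u2 i w * ev emb \<gamma> w ^ (q ^ p)) = (y(j := x1)) i p" by blast
          define u where "u i w = (if i \<in> J then u1 i w + (if w \<in> (\<Inter>i\<in>J. W i) then u2 j w else 0) else u2 i w)" for i w
          have "x2 p + (\<Sum>w\<in>W i. u i w * ev emb \<gamma> w ^ (q ^ p)) = y i p" if i: "i \<in> I" "p < h i" for i p
          proof (cases "i \<in> J")
            case False
            hence ij: "i \<noteq> j" "i \<in> ?I" using j i by auto
            moreover have "(\<Sum>w\<in>W i. u i w * ev emb \<gamma> w ^ (q ^ p)) = (\<Sum>w\<in>W i. u2 i w * ev emb \<gamma> w ^ (q ^ p))"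
              using False by (simp add: u_def)
            ultimately show ?thesis using bspec[OF 2 ij(2)] i by simp
          next
            case True
            have "p < Max (h ` J)" using True i finJ by (meson Max_ge finite_imageI image_eqI less_le_trans)
            with 2 have x2: "x2 p + (\<Sum>w\<in>(\<Inter>i\<in>J. W i). u2 j w * ev emb \<gamma> w ^ (q ^ p)) = x1 p" by auto
            have "(\<Sum>w\<in>W i. u i w * ev emb \<gamma> w ^ (q ^ p)) = (\<Sum>w\<in>W i. u1 i w * ev emb \<gamma> w ^ (q ^ p))
               + (\<Sum>w\<in>W i. (if w \<in> (\<Inter>i\<in>J. W i) then u2 j w else 0) * ev emb \<gamma> w ^ (q ^ p))"
              using True by (simp add: u_def distrib_right sum.distrib)
            also have "(\<Sum>w\<in>W i. (if w \<in> (\<Inter>i\<in>J. W i) then u2 j w else 0) * ev emb \<gamma> w ^ (q ^ p))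
               = (\<Sum>w\<in>(\<Inter>i\<in>J. W i). u2 j w * ev emb \<gamma> w ^ (q ^ p))"
              using True by (intro sum.mono_neutral_cong_right) auto
            finally have "x2 p + (\<Sum>w\<in>W i. u i w * ev emb \<gamma> w ^ (q ^ p)) = (x2 p + (\<Sum>w\<in>(\<Inter>i\<in>J. W i). u2 j w * ev emb \<gamma> w ^ (q ^ p)))
               + (\<Sum>w\<in>W i. u1 i w * ev emb \<gamma> w ^ (q ^ p))" by (simp only: add_ac)
            also have "\<dots> = y i p" unfolding x2 using 1 True i(2) by blast
            finally show ?thesis .
          qed
          thus ?thesis by blast
        qed
        thus ?thesis unfolding jointly_solvable_def by blast
      next
        case False
        have slack: "sum h J + vec.dim (\<Inter>i\<in>J. W i) < Max (h ` J) + (\<Sum>i\<in>J. vec.dim (W i))"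
          if "J \<subseteq> I" "1 < card J" "card J < card I" for J using False that by (meson not_le)
        have "Max (h ` I) \<in> h ` I" using fin Ine by (intro Max_in) auto
        then obtain i0 where i0: "i0 \<in> I" "h i0 = Max (h ` I)" by auto
        show ?thesis
        proof (cases "W i0 = X")
          case False
          then obtain x where x: "x \<in> X" "x \<notin> W i0" using W i0 by blast
          obtain c where c: "\<forall>w\<in>W i0. dotp c w = 0" "dotp c x = 1"
            using exists_separating_dotp[OF _ x(2)] W i0 by blast
          let ?K = "{w. dotp c w = 0}"
          have dim: "vec.dim (X \<inter> ?K) < vec.dim X" using dim_Int_dotp_kernel[OF X x(1), of c] c(2) by auto
          have W0: "\<And>i. i \<in> I \<Longrightarrow> vec.subspace (W i) \<and> vec.dim (W i) \<le> h i"
            and W0K: "W i0 \<subseteq> ?K" using W c by auto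
          have hyp1: "pattern_cond I (\<lambda>i. W i \<inter> ?K) (\<lambda>i. if W i \<subseteq> ?K then h i else h i - 1)"
            by (rule pattern_cond_hyperplane(1)[OF cond fin W0 i0 W0K slack])
          have hyp2: "vec.dim (W i \<inter> ?K) \<le> (if W i \<subseteq> ?K then h i else h i - 1)" if "i \<in> I" for i
            by (rule pattern_cond_hyperplane(2)[OF cond fin W0 i0 W0K slack that])
          have "\<exists>\<alpha>::'a^'n. jointly_solvable emb q I (\<lambda>i. W i \<inter> ?K) (\<lambda>i. if W i \<subseteq> ?K then h i else h i - 1) \<alpha>"
          proof (rule IH_dim[OF dim _ fin cI])
            show "vec.subspace (X \<inter> ?K)" using X subspace_dotp_kernel by (rule vec.subspace_inter)
            show "vec.subspace (W i \<inter> ?K) \<and> W i \<inter> ?K \<subseteq> X \<inter> ?K \<and> vec.dim (W i \<inter> ?K) \<le> (if W i \<subseteq> ?K then h i else h i - 1)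
              \<and> (if W i \<subseteq> ?K then h i else h i - 1) \<le> k" if "i \<in> I" for i
              using W[OF that] hyp2[OF that] subspace_dotp_kernel by (auto intro: vec.subspace_inter)
          qed (rule hyp1)
          then obtain \<alpha> :: "'a^'n" where
            "jointly_solvable emb q I (\<lambda>i. W i \<inter> ?K) (\<lambda>i. if W i \<subseteq> ?K then h i else h i - 1) \<alpha>" ..
          thus ?thesis
            by (rule jointly_solvable_lift_dotp[OF fe fin q, rotated 2])
              (use W sum_powers_le(2)[OF cI _ q1, of h k] Q in \<open>auto intro: le_less_trans[rotated]\<close>)
        next
          case True
          define d where "d = vec.dim X"
          have dk: "d \<le> k" using W[OF i0(1)] True by (simp add: d_def)
          \<comment> \<open>Since W i0 = X, the intersection for the pair \<open>{i0, i}\<close> is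
            W i, and in its condition everything but h i and dim X cancels.\<close>
          have hd: "h i \<le> d" if "i \<in> I" "i \<noteq> i0" for i
          proof -
            have "sum h {i0, i} + vec.dim (\<Inter>i\<in>{i0, i}. W i) \<le> Max (h ` {i0, i}) + (\<Sum>i\<in>{i0, i}. vec.dim (W i))"
              using that i0 by (intro pattern_condD[OF cond]) auto
            moreover have "h i \<le> h i0" using that fin by (simp add: i0)
            moreover have "X \<inter> W i = W i" using W that by auto
            ultimately show ?thesis using that True by (simp add: d_def)
          qed
          have cI': "card (I - {i0}) < card I" using fin i0 by (simp add: card_gt_0_iff Ine)
          have "\<exists>\<alpha>::'a^'n. jointly_solvable emb q (I - {i0}) W h \<alpha>"
            by (rule IH[OF cI']) (use fin cI cI' W pattern_cond_subset[OF cond] in auto)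
          \<comment> \<open>The Moore system has two members, X and {}, which is why
            \<open>2 \<le> m\<close> is assumed.\<close>
          moreover have "2 * d * q ^ d \<le> m * k * q ^ k"
            using dk m q1 by (intro mult_mono power_increasing) auto
          then have "\<exists>\<alpha>::'a^'n. jointly_solvable emb q UNIV (\<lambda>b. if b then X else {}) (\<lambda>b. if b then d else d) \<alpha>"
            using moore_solvable[OF fe q _ X, of d] Q unfolding d_def by simp
          ultimately obtain \<alpha> \<beta> :: "'a^'n" where \<alpha>: "jointly_solvable emb q (I - {i0}) W h \<alpha>"
            and \<beta>: "jointly_solvable emb q UNIV (\<lambda>b. if b then X else {}) (\<lambda>b::bool. d) \<beta>"
            by auto
          have "\<exists>\<gamma>. jointly_solvable emb q (I - {i0}) W h \<gamma>
             \<and> jointly_solvable emb q UNIV (\<lambda>b. if b then X else {}) (\<lambda>b::bool. d) \<gamma>"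
            by (rule common[OF _ _ _ _ _ _ \<alpha> \<beta>]) (use fin cI cI' W dk m in auto)
          then obtain \<gamma> :: "'a^'n" where \<gamma>: "jointly_solvable emb q (I - {i0}) W h \<gamma>"
            "jointly_solvable emb q UNIV (\<lambda>b. if b then X else {}) (\<lambda>b::bool. d) \<gamma>" by blast
          have "\<exists>x u. \<forall>i\<in>I. \<forall>p<h i. x p + (\<Sum>w\<in>W i. u i w * ev emb \<gamma> w ^ (q ^ p)) = y i p" for y
          proof -
            from \<gamma>(1)[unfolded jointly_solvable_def, THEN spec[of _ y]] obtain x1 u1 where
              1: "\<forall>i\<in>I - {i0}. \<forall>p<h i. x1 p + (\<Sum>w\<in>W i. u1 i w * ev emb \<gamma> w ^ (q ^ p)) = y i p" by blast
            \<comment> \<open>Member \<open>False\<close> has no vectors and target 0, so it forces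
              \<open>x2\<close> to vanish below d; the vectors of X alone then produce the
              prescribed difference.\<close>
            from \<gamma>(2)[unfolded jointly_solvable_def, THEN spec[of _ "\<lambda>b p. if b then y i0 p - x1 p else 0"]] obtain x2 u2 where
              2: "\<forall>b\<in>UNIV. \<forall>p<d. x2 p + (\<Sum>w\<in>(if b then X else {}). u2 b w * ev emb \<gamma> w ^ (q ^ p)) = (if b then y i0 p - x1 p else 0)" by blast
            have 3: "(\<Sum>w\<in>X. u2 True w * ev emb \<gamma> w ^ (q ^ p)) = y i0 p - x1 p" if "p < d" for p
              using bspec[OF 2, of True] bspec[OF 2, of False] that by simp
            \<comment> \<open>Below d this is \<open>x1\<close>, and the other members see no
              further coordinates; from d on it is whatever the equations of \<open>i0\<close>
              require.\<close>
            define x where "x p = y i0 p - (\<Sum>w\<in>X. u2 True w * ev emb \<gamma> w ^ (q ^ p))" for p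
            define u where "u = u1(i0 := u2 True)"
            have "x p + (\<Sum>w\<in>W i. u i w * ev emb \<gamma> w ^ (q ^ p)) = y i p" if "i \<in> I" "p < h i" for i p
            proof (cases "i = i0")
              case T: True
              thus ?thesis using True by (simp add: x_def u_def)
            next
              case False
              hence "x p = x1 p" using 3[of p] hd[OF that(1)] that(2) by (simp add: x_def)
              thus ?thesis using 1 False that by (simp add: u_def)
            qed
            thus ?thesis by blast
          qed
          thus ?thesis unfolding jointly_solvable_def by blast
        qed
      qed
    qed
  qed
qed

section \<open>From solvable systems to attained patterns\<close>

lemma finite_field_power_card:
  fixes c :: "'b::{finite,field}"
  shows "c ^ CARD('b) = c"
proof (cases "c = 0")
  case False
  let ?U = "UNIV - {0 :: 'b}"
  have "bij_betw ((*) c) ?U ?U"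
    using False by (intro bij_betwI[of _ _ _ "\<lambda>x. x / c"]) auto
  hence "(\<Prod>x\<in>?U. x) = (\<Prod>x\<in>?U. c * x)" by (rule prod.reindex_bij_betw[symmetric])
  also have "\<dots> = c ^ card ?U * (\<Prod>x\<in>?U. x)" by (simp add: prod.distrib)
  finally have 1: "c ^ card ?U = 1" by simp
  have 2: "CARD('b) = Suc (card ?U)" by (rule card_Suc_Diff1[symmetric]) simp_all
  show ?thesis unfolding 2 power_Suc 1 by simp
qed (simp add: power_0_left)

text \<open>For an arbitrary y in the subfield, (X + y)^q - X^q - y^q has degree below q and vanishes
  on all q elements of the subfield, so it is the zero polynomial; this avoids showing that q is
  a power of the characteristic.\<close>
lemma power_card_add:
  fixes emb :: "'b::{finite,field} \<Rightarrow> 'a::field"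
  assumes fe: "field_embedding emb" and q: "CARD('b) = q"
  shows "(x + y) ^ q = x ^ q + (y::'a) ^ q"
proof -
  have emb1: "emb 1 = 1" and emb_add: "emb (x + y) = emb x + emb y" and emb_mult: "emb (x * y) = emb x * emb y" for x y
    using fe by (auto simp: field_embedding_def)
  have emb_q: "emb c ^ q = emb c" for c
  proof -
    have "emb (c ^ i) = emb c ^ i" for i by (induction i) (simp_all add: emb1 emb_mult)
    thus ?thesis using finite_field_power_card[of c] q by metis
  qed
  have inj: "inj emb"
  proof (rule injI, rule ccontr)
    fix a b assume eq: "emb a = emb b" and ne: "a \<noteq> b"
    have "emb (a - b) = 0" using emb_add[of "a - b" b] eq by simp
    hence "emb ((a - b) * inverse (a - b)) = 0" by (simp add: emb_mult)
    thus False using ne emb1 by simp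
  qed
  \<comment> \<open>The instance y = 1 is enough, since x + y = y (1 + x / y) for nonzero y.\<close>
  define P :: "'a poly" where "P = [:1, 1:] ^ q - monom 1 q - 1"
  have q0: "q > 0" using q by auto
  have "P = 0"
  proof (rule ccontr)
    assume P0: "P \<noteq> 0"
    have "coeff ([:1, 1:] ^ q :: 'a poly) q = 1" and "degree ([:1, 1:] ^ q :: 'a poly) = q"
      using lead_coeff_power[of "[:1, 1 :: 'a:]" q] degree_power_eq[of "[:1, 1 :: 'a:]" q] by simp_all
    hence "coeff P n = 0" if "n \<ge> q" for n
      using that q0 by (cases "n = q") (auto simp: P_def coeff_eq_0)
    hence "degree P < q" using q0 by (metis P0 leading_coeff_0_iff not_le)
    moreover have "range emb \<subseteq> {x. poly P x = 0}"
    proof safe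
      fix c
      have "poly P (emb c) = (1 + emb c) ^ q - emb c ^ q - 1" by (simp add: P_def poly_monom)
      also have "1 + emb c = emb (1 + c)" by (simp add: emb1 emb_add)
      finally show "poly P (emb c) = 0" by (simp only: emb_q) (simp add: emb1 emb_add)
    qed
    hence "card (range emb) \<le> card {x. poly P x = 0}" by (intro card_mono poly_roots_finite P0)
    moreover have "card (range emb) = q" using inj q by (simp add: card_image)
    ultimately show False using card_poly_roots_bound[OF P0] by linarith
  qed
  hence one: "(1 + z) ^ q = z ^ q + 1" for z :: 'a
  proof -
    assume "P = 0"
    hence "poly P z = 0" by simp
    thus ?thesis by (simp add: P_def poly_monom algebra_simps)
  qed
  show ?thesis
  proof (cases "y = 0")
    case False
    hence "x + y = y * (1 + x / y)" by (simp add: field_simps)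
    hence "(x + y) ^ q = y ^ q * (x / y) ^ q + y ^ q" by (simp only: power_mult_distrib one) (simp add: algebra_simps)
    thus ?thesis using False by (simp add: power_divide)
  qed (use q0 in \<open>simp add: power_0_left\<close>)
qed

text \<open>The q-th power map is additive and fixes the image of \<open>emb\<close>, so it acts on
  the coordinates of \<alpha> alone. Hence the Moore entries are F_q-linear in w, and a q-polynomial
  vanishing at a basis vanishes on its span.\<close>

lemma ev_power:
  fixes emb :: "'b::{finite,field} \<Rightarrow> 'a::field"
  assumes fe: "field_embedding emb" and q: "CARD('b) = q"
  shows "ev emb \<alpha> w ^ (q ^ r) = (\<Sum>j\<in>UNIV. emb (vec_nth w j) * vec_nth \<alpha> j ^ (q ^ r))"
proof -
  have "emb (c ^ i) = emb c ^ i" for c i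
    using fe by (induction i) (auto simp: field_embedding_def)
  hence emb_q: "emb c ^ q = emb c" for c using finite_field_power_card[of c] q by metis
  have q0: "q > 0" using q by auto
  have sum_q: "(sum f A) ^ q = (\<Sum>x\<in>A. f x ^ q)" for f :: "'n \<Rightarrow> 'a" and A
    by (induction A rule: infinite_finite_induct) (use q0 in \<open>auto simp: power_card_add[OF fe q] power_0_left\<close>)
  show ?thesis
  proof (induction r)
    case (Suc r)
    have "ev emb \<alpha> w ^ (q ^ Suc r) = (ev emb \<alpha> w ^ (q ^ r)) ^ q" by (simp add: mult.commute flip: power_mult)
    also have "\<dots> = (\<Sum>j\<in>UNIV. emb (vec_nth w j) * vec_nth \<alpha> j ^ (q ^ Suc r))"
      unfolding Suc.IH sum_q by (simp add: power_mult_distrib emb_q power_mult mult.commute[of q])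
    finally show ?case .
  qed (simp add: ev_def)
qed

text \<open>By pigeonhole: there are more coefficient vectors than vectors of values on B, and the
  difference of two coefficient vectors with the same values annihilates all of B.\<close>

lemma exists_nonzero_annihilator:
  fixes f :: "'w \<Rightarrow> nat \<Rightarrow> 'a::{finite,field}"
  assumes "finite B" and "card B < k"
  shows "\<exists>m. (\<exists>p<k. m p \<noteq> 0) \<and> (\<forall>b\<in>B. (\<Sum>p<k. m p * f b p) = 0)"
proof -
  let ?F = "\<lambda>m. restrict (\<lambda>b. \<Sum>p<k. m p * f b p) B"
  let ?D = "{..<k} \<rightarrow>\<^sub>E (UNIV :: 'a set)" and ?E = "B \<rightarrow>\<^sub>E (UNIV :: 'a set)"
  have "card {0, 1 :: 'a} \<le> CARD('a)" by (intro card_mono) auto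
  hence "CARD('a) > 1" by simp
  hence "card ?E < card ?D" using assms by (simp add: card_PiE)
  moreover have "?F ` ?D \<subseteq> ?E" by auto
  moreover have "finite ?E" using assms(1) by (intro finite_PiE) auto
  ultimately have "\<not> inj_on ?F ?D" by (meson card_inj_on_le not_le)
  then obtain m1 m2 where m: "m1 \<in> ?D" "m2 \<in> ?D" "?F m1 = ?F m2" "m1 \<noteq> m2"
    by (auto simp: inj_on_def)
  have "\<exists>p<k. m1 p - m2 p \<noteq> 0"
  proof (rule ccontr)
    assume "\<not> ?thesis"
    hence "m1 = m2" by (intro PiE_ext[OF m(1,2)]) auto
    with m show False by simp
  qed
  moreover have "(\<Sum>p<k. (m1 p - m2 p) * f b p) = 0" if "b \<in> B" for b
    using fun_cong[OF m(3), of b] that by (simp add: left_diff_distrib sum_subtractf)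
  ultimately show ?thesis by (intro exI[of _ "\<lambda>p. m1 p - m2 p"]) auto
qed

text \<open>Row i of M consists of the coefficients of a nonzero q-polynomial of q-degree below k
  that vanishes on \<alpha>(W i); it exists because dim W i < k. Applied to the equations of member
  i it kills the terms with \<open>u\<close>, so M i x = M i (y i), and suitable right-hand sides y
  give the columns of a right inverse of M.\<close>

lemma jointly_solvable_imp_annihilators:
  fixes emb :: "'b::{finite,field} \<Rightarrow> 'a::{finite,field}" and W :: "nat \<Rightarrow> ('b^'n) set"
  assumes fe: "field_embedding emb" and q: "CARD('b) = q"
    and W: "\<And>i. i < k \<Longrightarrow> vec.subspace (W i)" and dimW: "\<And>i. i < k \<Longrightarrow> vec.dim (W i) < k"
    and sol: "jointly_solvable emb q {..<k} W (\<lambda>_. k) \<alpha>"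
  shows "\<exists>M. invertible_sq k M \<and> (\<forall>i<k. \<forall>w\<in>W i. (\<Sum>r<k. M i r * ev emb \<alpha> w ^ (q ^ r)) = 0)"
proof -
  have "\<exists>m. (\<exists>p<k. m p \<noteq> 0) \<and> (\<forall>w\<in>W i. (\<Sum>p<k. m p * ev emb \<alpha> w ^ (q ^ p)) = 0)" if i: "i < k" for i
  proof -
    obtain B where B: "B \<subseteq> W i" "vec.independent B" "W i \<subseteq> vec.span B" "card B = vec.dim (W i)"
      using vec.basis_exists by blast
    have "finite B" by simp
    then obtain m where m: "\<exists>p<k. m p \<noteq> 0" "\<forall>b\<in>B. (\<Sum>p<k. m p * ev emb \<alpha> b ^ (q ^ p)) = 0"
      using exists_nonzero_annihilator[of B k "\<lambda>b p. ev emb \<alpha> b ^ (q ^ p)"] B(4) dimW[OF i] by auto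
    let ?Z = "{w. (\<Sum>p<k. m p * ev emb \<alpha> w ^ (q ^ p)) = 0}"
    have emb: "emb (x + y) = emb x + emb y" "emb (x * y) = emb x * emb y" "emb 0 = 0" for x y
      using fe field_embedding_zero[OF fe] by (auto simp: field_embedding_def)
    have "(\<Sum>p<k. m p * ev emb \<alpha> (c *s v) ^ (q ^ p)) = emb c * (\<Sum>p<k. m p * ev emb \<alpha> v ^ (q ^ p))" for c v
      by (simp add: ev_power[OF fe q] emb sum_distrib_left mult_ac)
    moreover have "(\<Sum>p<k. m p * ev emb \<alpha> (v + w) ^ (q ^ p)) =
       (\<Sum>p<k. m p * ev emb \<alpha> v ^ (q ^ p)) + (\<Sum>p<k. m p * ev emb \<alpha> w ^ (q ^ p))" for v w
      by (simp add: ev_power[OF fe q] emb sum.distrib distrib_left distrib_right)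
    moreover have "0 \<in> ?Z" by (simp add: ev_power[OF fe q] emb)
    ultimately have "vec.subspace ?Z" unfolding vec.subspace_def by simp
    hence "vec.span B \<subseteq> ?Z" using m(2) by (intro vec.span_minimal) auto
    thus ?thesis using m(1) B(3) by blast
  qed
  then obtain M where M: "\<And>i. i < k \<Longrightarrow> \<exists>p<k. M i p \<noteq> 0"
    "\<And>i w. i < k \<Longrightarrow> w \<in> W i \<Longrightarrow> (\<Sum>p<k. M i p * ev emb \<alpha> w ^ (q ^ p)) = 0"
    by metis
  then obtain e where e: "\<And>i. i < k \<Longrightarrow> e i < k" "\<And>i. i < k \<Longrightarrow> M i (e i) \<noteq> 0" by metis
  have "\<exists>x. \<forall>i<k. (\<Sum>p<k. M i p * x p) = (if i = j then 1 else 0)" for j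
  proof -
    \<comment> \<open>A single coordinate \<open>e i\<close> at which row i of M is nonzero carries
      the target, normalised so that the row takes the value 1 on it.\<close>
    let ?y = "\<lambda>i p. if i = j \<and> p = e i then 1 / M i (e i) else 0"
    obtain x u where xu: "\<forall>i\<in>{..<k}. \<forall>p<k. x p + (\<Sum>w\<in>W i. u i w * ev emb \<alpha> w ^ (q ^ p)) = ?y i p"
      using sol[unfolded jointly_solvable_def, THEN spec[of _ ?y]] by blast
    have "(\<Sum>p<k. M i p * x p) = (if i = j then 1 else 0)" if i: "i < k" for i
    proof -
      have "(\<Sum>p<k. M i p * ?y i p) = (\<Sum>p<k. M i p * x p) + (\<Sum>p<k. M i p * (\<Sum>w\<in>W i. u i w * ev emb \<alpha> w ^ (q ^ p)))"
        unfolding sum.distrib[symmetric] distrib_left[symmetric] using xu i by (intro sum.cong) auto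
      also have "(\<Sum>p<k. M i p * (\<Sum>w\<in>W i. u i w * ev emb \<alpha> w ^ (q ^ p))) =
         (\<Sum>w\<in>W i. u i w * (\<Sum>p<k. M i p * ev emb \<alpha> w ^ (q ^ p)))"
        by (simp add: sum_distrib_left sum.swap[of _ "W i"] mult_ac)
      also have "\<dots> = 0" using M(2)[OF i] by simp
      also have "(\<Sum>p<k. M i p * ?y i p) = (\<Sum>p<k. if p = e i then (if i = j then 1 else 0) else 0)"
        using e(2)[OF i] by (intro sum.cong) auto
      also have "\<dots> = (if i = j then 1 else 0)" using e(1)[OF i] by simp
      finally show ?thesis by simp
    qed
    thus ?thesis by blast
  qed
  then obtain X where X: "\<And>i j. i < k \<Longrightarrow> (\<Sum>p<k. M i p * X j p) = (if i = j then 1 else 0)" by metis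
  hence "invertible_sq k M"
    unfolding invertible_sq_def
    using nat_matrix_left_inverse[of k M "\<lambda>r j. X j r"] by (intro exI[of _ "\<lambda>r j. X j r"]) simp
  with M(2) show ?thesis by blast
qed

lemma annihilators_imp_attains:
  fixes emb :: "'b::{finite,field} \<Rightarrow> 'a::{finite,field}" and V :: "nat \<Rightarrow> ('b^'n) set"
  assumes fe: "field_embedding emb" and q: "CARD('b) = q"
    and M: "invertible_sq k M" "\<And>i v. i < k \<Longrightarrow> v \<in> V i \<Longrightarrow> (\<Sum>r<k. M i r * ev emb \<alpha> v ^ (q ^ r)) = 0"
  shows "attains emb k (gab_gen q \<alpha>) V"
  unfolding attains_def
proof (intro allI impI exI[of _ M] conjI ballI)
  fix A i c assume A: "\<forall>i<k. full_rank_basis_matrix (V i) (A i)" and i: "i < k" and c: "c \<in> set (A i)"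
  have "c \<in> V i" using A i c vec.span_superset unfolding full_rank_basis_matrix_def by blast
  hence "0 = (\<Sum>r<k. M i r * (\<Sum>j\<in>UNIV. emb (vec_nth c j) * vec_nth \<alpha> j ^ (q ^ r)))"
    using M(2)[OF i] by (simp add: ev_power[OF fe q])
  also have "\<dots> = (\<Sum>j\<in>UNIV. (\<Sum>r<k. M i r * gab_gen q \<alpha> r j) * emb (vec_nth c j))"
    by (simp add: gab_gen_def sum_distrib_left sum_distrib_right sum.swap[of _ "{..<k}"] mult_ac)
  finally show "(\<Sum>j\<in>UNIV. (\<Sum>r<k. M i r * gab_gen q \<alpha> r j) * emb (vec_nth c j)) = 0" by simp
qed (rule M(1))

section \<open>Counting evaluation points for one pattern\<close>

definition pad :: "'x::zero^'n \<Rightarrow> 'x^'c \<Rightarrow> 'x^('n + 'c)" where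
  "pad v z = (\<chi> s. case s of Inl j \<Rightarrow> vec_nth v j | Inr c \<Rightarrow> vec_nth z c)"

lemma pad_nth [simp]: "vec_nth (pad v z) (Inl j) = vec_nth v j" "vec_nth (pad v z) (Inr c) = vec_nth z c"
  by (simp_all add: pad_def)

lemma pad_components: "pad (\<chi> j. vec_nth w (Inl j)) (\<chi> c. vec_nth w (Inr c)) = w"
proof -
  have "vec_nth (pad (\<chi> j. vec_nth w (Inl j)) (\<chi> c. vec_nth w (Inr c))) s = vec_nth w s" for s
    by (cases s) simp_all
  thus ?thesis by (simp add: Finite_Cartesian_Product.vec_eq_iff)
qed

lemma ev_pad_zero:
  fixes emb :: "'b::field \<Rightarrow> 'a::field" and \<alpha> :: "'a^'c" and \<gamma> :: "'a^'d"
  assumes "field_embedding emb"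
  shows "ev emb (pad \<alpha> \<gamma>) (pad v 0) = ev emb \<alpha> v"
proof -
  have "sum g UNIV = (\<Sum>j\<in>UNIV. g (Inl j)) + (\<Sum>c\<in>UNIV. g (Inr c))" for g :: "'c + 'd \<Rightarrow> 'a"
    using sum.Plus[of "UNIV :: 'c set" "UNIV :: 'd set" g] by simp
  thus ?thesis using assms by (simp add: ev_def field_embedding_zero)
qed

lemma pad_add_smult: "pad (\<alpha> + t *s \<beta>) \<gamma> = pad \<alpha> \<gamma> + t *s pad \<beta> 0" for \<alpha> \<beta> :: "'a::field^'n"
proof -
  have "vec_nth (pad (\<alpha> + t *s \<beta>) \<gamma>) s = vec_nth (pad \<alpha> \<gamma> + t *s pad \<beta> 0) s" for s
    by (cases s) simp_all
  thus ?thesis by (simp add: Finite_Cartesian_Product.vec_eq_iff)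
qed

definition pad_space :: "('b::field^'n) set \<Rightarrow> 'c::finite set \<Rightarrow> ('b^('n + 'c)) set" where
  "pad_space V T = {w. (\<chi> j. vec_nth w (Inl j)) \<in> V \<and> (\<forall>c. vec_nth w (Inr c) \<noteq> 0 \<longrightarrow> c \<in> T)}"

lemma mem_pad_space:
  "w \<in> pad_space V T \<longleftrightarrow> (\<chi> j. vec_nth w (Inl j)) \<in> V \<and> (\<forall>c. c \<notin> T \<longrightarrow> vec_nth w (Inr c) = 0)"
  unfolding pad_space_def by blast

lemma subspace_pad_space:
  fixes V :: "('b::field^'n) set" and T :: "'c::finite set"
  assumes V: "vec.subspace V"
  shows "vec.subspace (pad_space V T)"
proof (rule vec.subspaceI)
  have "(\<chi> j. vec_nth (0 :: 'b^('n + 'c)) (Inl j)) = 0" by (simp add: Finite_Cartesian_Product.vec_eq_iff)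
  thus "0 \<in> pad_space V T" using vec.subspace_0[OF V] by (simp add: pad_space_def)
next
  fix v w :: "'b^('n + 'c)" assume *: "v \<in> pad_space V T" "w \<in> pad_space V T"
  have "(\<chi> j. vec_nth (v + w) (Inl j)) = (\<chi> j. vec_nth v (Inl j)) + (\<chi> j. vec_nth w (Inl j))"
    by (simp add: Finite_Cartesian_Product.vec_eq_iff)
  also have "\<dots> \<in> V" using * by (intro vec.subspace_add[OF V]) (simp_all only: mem_pad_space)
  finally show "v + w \<in> pad_space V T" using * unfolding mem_pad_space by simp
next
  fix a and v :: "'b^('n + 'c)" assume *: "v \<in> pad_space V T"
  have "(\<chi> j. vec_nth (a *s v) (Inl j)) = a *s (\<chi> j. vec_nth v (Inl j))"
    by (simp add: Finite_Cartesian_Product.vec_eq_iff)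
  also have "\<dots> \<in> V" using * by (intro vec.subspace_scale[OF V]) (simp only: mem_pad_space)
  finally show "a *s v \<in> pad_space V T" using * unfolding mem_pad_space by simp
qed

lemma pad_space_empty: "pad_space V {} = (\<lambda>v. pad v 0) ` V"
proof (rule Set.set_eqI, rule iffI)
  fix w assume w: "w \<in> pad_space V {}"
  have "vec_nth w (Inr c) = 0" for c using w by (simp only: mem_pad_space empty_iff not_False_eq_True simp_thms)
  hence "(\<chi> c. vec_nth w (Inr c)) = 0" by (simp add: Finite_Cartesian_Product.vec_eq_iff)
  hence "w = pad (\<chi> j. vec_nth w (Inl j)) 0" using pad_components[of w] by simp
  moreover have "(\<chi> j. vec_nth w (Inl j)) \<in> V" using w by (simp only: mem_pad_space)
  ultimately show "w \<in> (\<lambda>v. pad v 0) ` V" by (rule image_eqI)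
next
  fix w assume "w \<in> (\<lambda>v. pad v 0) ` V"
  thus "w \<in> pad_space V {}" unfolding mem_pad_space by auto
qed

text \<open>Induction on T: the coordinate functional of a new c is nonzero on the larger space, and
  its kernel there is the smaller one.\<close>

lemma dim_pad_space:
  fixes V :: "('b::field^'n) set" and T :: "'c::finite set"
  assumes V: "vec.subspace V"
  shows "vec.dim (pad_space V T) = vec.dim V + card T"
proof -
  have "finite T" by simp
  thus ?thesis
  proof (induction T)
    case empty
    have add: "pad (v + w) (0 :: 'b^'c) = pad v 0 + pad w 0" for v w :: "'b^'n"
      using pad_add_smult[of v 1 w "0 :: 'b^'c"] by simp
    have scale: "pad (a *s v) (0 :: 'b^'c) = a *s pad v 0" for v :: "'b^'n" and a
    proof -
      have "vec_nth (pad (a *s v) (0 :: 'b^'c)) s = vec_nth (a *s pad v 0) s" for s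
        by (cases s) simp_all
      thus ?thesis by (simp add: Finite_Cartesian_Product.vec_eq_iff)
    qed
    have "Vector_Spaces.linear (*s) (*s) (\<lambda>v :: 'b^'n. pad v (0 :: 'b^'c))"
      by unfold_locales (simp_all only: add scale)
    moreover have "inj (\<lambda>v :: 'b^'n. pad v (0 :: 'b^'c))"
      by (rule injI) (metis pad_nth(1) Finite_Cartesian_Product.vec_eq_iff)
    ultimately show ?case
      unfolding pad_space_empty by (subst vec.dim_image_eq) (auto intro: inj_on_subset)
  next
    case (insert c T)
    let ?c = "axis (Inr c) 1 :: 'b^('n + 'c)"
    have dotp: "dotp ?c w = vec_nth w (Inr c)" for w
      unfolding dotp_def axis_def by (simp add: if_distrib[where f="\<lambda>x. x * _"] cong: if_cong)
    have "(\<chi> j. vec_nth ?c (Inl j)) = 0" by (simp add: Finite_Cartesian_Product.vec_eq_iff axis_def)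
    hence "?c \<in> pad_space V (insert c T)"
      using vec.subspace_0[OF V] by (auto simp: pad_space_def) (auto simp: axis_def split: if_splits)
    moreover have "dotp ?c ?c \<noteq> 0" unfolding dotp by (simp add: axis_def)
    ultimately have "vec.dim (pad_space V (insert c T)) = vec.dim (pad_space V (insert c T) \<inter> {w. dotp ?c w = 0}) + 1"
      by (rule dim_Int_dotp_kernel[OF subspace_pad_space[OF V]])
    also have "pad_space V (insert c T) \<inter> {w. dotp ?c w = 0} = pad_space V T"
      using insert.hyps by (auto simp: dotp pad_space_def)
    finally show ?case using insert by simp
  qed
qed

text \<open>Adjoining new coordinates in disjoint blocks raises every member of a generic kernel pattern
  to dimension k - 1 without changing the intersection of two or more members.\<close>
lemma generic_kp_extend:
  fixes V :: "nat \<Rightarrow> ('b::field^'n) set"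
  assumes kp: "kernel_pattern k V" and gen: "generic_kp k V" and k: "k \<le> CARD('n)"
  shows "\<exists>W :: nat \<Rightarrow> ('b^('n + 'n \<times> 'n)) set.
     (\<forall>i<k. vec.subspace (W i) \<and> vec.dim (W i) = k - 1 \<and> (\<forall>v\<in>V i. pad v 0 \<in> W i)) \<and>
     pattern_cond {..<k} W (\<lambda>_. k)"
proof -
  have subV: "vec.subspace (V i)" if "i < k" for i using kp that by (simp add: kernel_pattern_def)
  have dimV: "vec.dim (\<Inter>i\<in>J. V i) \<le> k - card J" if "J \<subseteq> {..<k}" "J \<noteq> {}" for J
    using gen that by (simp add: generic_kp_def)
  have dimV1: "vec.dim (V i) \<le> k - 1" if "i < k" for i using dimV[of "{i}"] that by simp
  \<comment> \<open>Row \<open>\<iota> i\<close> of the grid \<open>'n \<times> 'n\<close> is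
    reserved for index i; as k \<le> n, it has room for the missing k - 1 - dim V i dimensions, and
    distinct rows are disjoint.\<close>
  obtain \<iota> :: "nat \<Rightarrow> 'n" where \<iota>: "inj_on \<iota> {..<k}"
    using card_le_inj[of "{..<k}" "UNIV :: 'n set"] k by auto
  have "\<exists>S :: 'n set. card S = k - 1 - vec.dim (V i)" for i
    using obtain_subset_with_card_n[of "k - 1 - vec.dim (V i)" "UNIV :: 'n set"] k
    by (metis diff_le_self le_trans)
  then obtain S :: "nat \<Rightarrow> 'n set" where S: "\<And>i. card (S i) = k - 1 - vec.dim (V i)" by metis
  define T where "T i = {\<iota> i} \<times> S i" for i
  define W where "W i = pad_space (V i) (T i)" for i
  have dimW: "vec.dim (W i) = k - 1" if "i < k" for i
    unfolding W_def dim_pad_space[OF subV[OF that]] T_def using dimV1[OF that] S[of i]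
    by (simp add: card_cartesian_product)
  have inW: "pad v 0 \<in> W i" if "v \<in> V i" for v i using that by (simp add: W_def pad_space_def)
  have "pattern_cond {..<k} W (\<lambda>_. k)"
    unfolding pattern_cond_def
  proof (intro allI impI)
    fix J assume J: "J \<subseteq> {..<k}" "J \<noteq> {}"
    have finJ: "finite J" using J(1) finite_subset by blast
    have cJ: "card J \<le> k" "card J > 0" using card_mono[OF _ J(1)] J finJ by auto
    have sd: "(\<Sum>i\<in>J. vec.dim (W i)) = card J * (k - 1)" using dimW J by (simp add: subset_eq)
    have mx: "Max ((\<lambda>_. k) ` J) = k" using image_constant_conv[of k J] J(2) by simp
    have "card J * k + vec.dim (\<Inter>i\<in>J. W i) \<le> k + card J * (k - 1)"
    proof (cases "card J = 1")
      case True
      then obtain i where "J = {i}" by (auto simp: card_1_singleton_iff)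
      thus ?thesis using dimW J by simp
    next
      case False
      hence "card J > 1" using cJ by simp
      then obtain i i' where ii: "i \<in> J" "i' \<in> J" "i \<noteq> i'"
        by (metis card_le_Suc0_iff_eq finJ not_le One_nat_def)
      have "T i \<inter> T i' = {}" using inj_onD[OF \<iota>, of i i'] ii J by (auto simp: T_def)
      hence "(\<Inter>i\<in>J. W i) \<subseteq> pad_space (\<Inter>i\<in>J. V i) ({} :: ('n \<times> 'n) set)" using ii by (auto simp: W_def pad_space_def)
      hence "vec.dim (\<Inter>i\<in>J. W i) \<le> vec.dim (pad_space (\<Inter>i\<in>J. V i) ({} :: ('n \<times> 'n) set))"
        by (rule vec.dim_subset)
      also have "vec.subspace (\<Inter>i\<in>J. V i)" using subV J by (intro vec.subspace_Inter) auto
      hence "vec.dim (pad_space (\<Inter>i\<in>J. V i) ({} :: ('n \<times> 'n) set)) = vec.dim (\<Inter>i\<in>J. V i)"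
        by (simp add: dim_pad_space)
      finally have "vec.dim (\<Inter>i\<in>J. W i) \<le> vec.dim (\<Inter>i\<in>J. V i)" .
      hence "vec.dim (\<Inter>i\<in>J. W i) \<le> k - card J" using dimV[OF J] by linarith
      moreover have "card J * k = card J * (k - 1) + card J" using cJ by (cases k) auto
      ultimately show ?thesis using cJ by linarith
    qed
    thus "(\<Sum>i\<in>J. k) + vec.dim (\<Inter>i\<in>J. W i) \<le> Max ((\<lambda>_. k) ` J) + (\<Sum>i\<in>J. vec.dim (W i))"
      using sd mx by simp
  qed
  moreover have subW: "vec.subspace (W i)" if "i < k" for i
    unfolding W_def by (rule subspace_pad_space[OF subV[OF that]])
  moreover have "\<forall>i<k. vec.subspace (W i) \<and> vec.dim (W i) = k - 1 \<and> (\<forall>v\<in>V i. pad v 0 \<in> W i)"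
    by (intro allI impI conjI ballI; rule subW dimW inW; assumption)
  ultimately show ?thesis by (intro exI[of _ W] conjI)
qed

text \<open>Count pairs of a point b of B and a nonzero t: writing b = \<alpha> + t \<beta> with
  \<beta> = (b - \<alpha>) / t embeds them into the pairs (\<beta>, t) with \<alpha> + t \<beta> in
  B, and each direction \<beta> has at most d of those.\<close>

lemma card_le_by_lines:
  fixes B :: "('a::{finite,field}^'n) set"
  assumes "\<And>\<beta>. card {t. \<alpha> + t *s \<beta> \<in> B} \<le> d"
  shows "card B * (CARD('a) - 1) \<le> d * CARD('a) ^ CARD('n)"
proof -
  let ?f = "\<lambda>(b, t). ((1 / t) *s (b - \<alpha>), t)"
  let ?P = "Sigma UNIV (\<lambda>\<beta>. {t. \<alpha> + t *s \<beta> \<in> B})"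
  have cancel: "t *s ((1 / t) *s v) = v" if "t \<noteq> 0" for t and v :: "'a^'n"
    using that by simp
  have "inj_on ?f (B \<times> (UNIV - {0}))"
  proof (rule inj_onI)
    fix x y assume "x \<in> B \<times> (UNIV - {0})" "?f x = ?f y"
    then obtain b b' t where "x = (b, t)" "y = (b', t)" "t \<noteq> 0" "(1 / t) *s (b - \<alpha>) = (1 / t) *s (b' - \<alpha>)"
      by (cases x, cases y) auto
    moreover from this have "b - \<alpha> = b' - \<alpha>" by (metis cancel)
    ultimately show "x = y" by simp
  qed
  moreover have "?f ` (B \<times> (UNIV - {0})) \<subseteq> ?P" by (auto simp: cancel)
  ultimately have "card (B \<times> (UNIV - {0 :: 'a})) \<le> card ?P" by (intro card_inj_on_le) auto
  also have "card (B \<times> (UNIV - {0 :: 'a})) = card B * (CARD('a) - 1)"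
    by (simp add: card_cartesian_product card_Diff_singleton)
  also have "card ?P = (\<Sum>\<beta>\<in>UNIV. card {t. \<alpha> + t *s \<beta> \<in> B})" by (simp add: card_SigmaI)
  also have "\<dots> \<le> (\<Sum>\<beta>\<in>(UNIV :: ('a^'n) set). d)" by (intro sum_mono assms)
  also have "\<dots> = d * CARD('a) ^ CARD('n)" by simp
  finally show ?thesis .
qed

lemma sum_powers_lt:
  fixes q :: nat
  assumes "2 \<le> q"
  shows "(\<Sum>p<k. q ^ p) < q ^ k"
proof (induction k)
  case (Suc k)
  have "2 * q ^ k \<le> q ^ Suc k" using mult_le_mono1[OF assms, of "q ^ k"] by simp
  with Suc show ?case unfolding sum.lessThan_Suc by linarith
qed simp

lemma card_not_attains_le:
  fixes V :: "nat \<Rightarrow> ('b::{finite,field}^'n) set" and emb :: "'b \<Rightarrow> 'a::{finite,field}"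
  assumes fe: "field_embedding emb" and q: "CARD('b) = q" "2 \<le> q"
    and kp: "kernel_pattern k V" "generic_kp k V" and k: "1 \<le> k" "k \<le> CARD('n)"
    and Q: "2 * ((k + 1) * k * q ^ k) + 1 < CARD('a)"
  shows "card {\<alpha> :: 'a^'n. \<not> attains emb k (gab_gen q \<alpha>) V} * (CARD('a) - 1) \<le> k * q ^ k * CARD('a) ^ CARD('n)"
proof -
  obtain W :: "nat \<Rightarrow> ('b^('n + 'n \<times> 'n)) set" where
    W: "\<And>i. i < k \<Longrightarrow> vec.subspace (W i)" "\<And>i. i < k \<Longrightarrow> vec.dim (W i) = k - 1"
       "\<And>i v. i < k \<Longrightarrow> v \<in> V i \<Longrightarrow> pad v 0 \<in> W i"
    and cond: "pattern_cond {..<k} W (\<lambda>_. k)"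
    using generic_kp_extend[OF kp k(2)] by blast
  \<comment> \<open>The number of members is bounded by k + 1 instead of k so that the bound is at
    least 2 even for k = 1.\<close>
  have "\<exists>\<alpha>::'a^('n + 'n \<times> 'n). jointly_solvable emb q {..<k} W (\<lambda>_. k) \<alpha>"
    using W k(1) by (intro pattern_cond_imp_solvable[OF fe q(2) Q _ vec.subspace_UNIV _ _ _ cond]) auto
  then obtain \<delta> :: "'a^('n + 'n \<times> 'n)" where \<delta>: "jointly_solvable emb q {..<k} W (\<lambda>_. k) \<delta>" ..
  define \<alpha> where "\<alpha> = (\<chi> j. vec_nth \<delta> (Inl j))"
  define \<gamma> where "\<gamma> = (\<chi> c. vec_nth \<delta> (Inr c))"
  have \<delta>_eq: "\<delta> = pad \<alpha> \<gamma>" by (simp add: \<alpha>_def \<gamma>_def pad_components)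
  let ?B = "{\<alpha>. \<not> jointly_solvable emb q {..<k} W (\<lambda>_. k) (pad \<alpha> \<gamma>)}"
  have att: "attains emb k (gab_gen q \<alpha>) V" if "jointly_solvable emb q {..<k} W (\<lambda>_. k) (pad \<alpha> \<gamma>)" for \<alpha>
  proof -
    have "vec.dim (W i) < k" if "i < k" for i using W(2)[OF that] k(1) by simp
    from jointly_solvable_imp_annihilators[OF fe q(1) W(1) this that] obtain M where
      M: "invertible_sq k M" "\<And>i w. i < k \<Longrightarrow> w \<in> W i \<Longrightarrow> (\<Sum>r<k. M i r * ev emb (pad \<alpha> \<gamma>) w ^ q ^ r) = 0"
      by blast
    have "(\<Sum>r<k. M i r * ev emb \<alpha> v ^ q ^ r) = 0" if "i < k" "v \<in> V i" for i v
      using M(2)[OF that(1) W(3)[OF that]] by (simp only: ev_pad_zero[OF fe])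
    with M(1) show ?thesis by (rule annihilators_imp_attains[OF fe q(1)])
  qed
  have "card {t. \<alpha> + t *s \<beta> \<in> ?B} \<le> k * q ^ k" for \<beta>
  proof -
    have "card {t. \<alpha> + t *s \<beta> \<in> ?B} \<le> (\<Sum>i<k. \<Sum>p<k. q ^ p)"
      using card_unsolvable_on_line[OF _ \<delta>, of "pad \<beta> 0"] by (simp add: pad_add_smult \<delta>_eq)
    also have "\<dots> \<le> k * q ^ k" using sum_powers_lt[OF q(2), of k] by simp
    finally show ?thesis .
  qed
  hence "card ?B * (CARD('a) - 1) \<le> k * q ^ k * CARD('a) ^ CARD('n)" by (rule card_le_by_lines)
  moreover have "card {\<alpha> :: 'a^'n. \<not> attains emb k (gab_gen q \<alpha>) V} \<le> card ?B"
    using att by (intro card_mono) auto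
  ultimately show ?thesis by (meson mult_le_mono1 order.trans)
qed

section \<open>Linearly independent coordinates and the MRD property\<close>

lemma CARD_field_ge_2: "2 \<le> CARD('a::{finite,field})"
proof -
  have "card {0, 1 :: 'a} \<le> CARD('a)" by (intro card_mono) auto
  thus ?thesis by simp
qed

lemma field_embedding_eq_0_iff:
  assumes "field_embedding emb"
  shows "emb c = 0 \<longleftrightarrow> c = 0"
proof
  assume c: "emb c = 0"
  show "c = 0"
  proof (rule ccontr)
    assume "c \<noteq> 0"
    hence "emb (c * inverse c) = 1" using assms by (simp add: field_embedding_def)
    moreover have "emb (c * inverse c) = emb c * emb (inverse c)" using assms unfolding field_embedding_def by blast
    ultimately show False using c by simp
  qed
qed (use field_embedding_zero[OF assms] in simp)

lemma ev_diff_right: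
  assumes fe: "field_embedding emb"
  shows "ev emb \<alpha> (w - w') = ev emb \<alpha> w - ev emb \<alpha> w'"
proof -
  have "emb (x - y) = emb x - emb y" for x y
  proof -
    have "emb (x - y + y) = emb (x - y) + emb y" using fe unfolding field_embedding_def by blast
    thus ?thesis by simp
  qed
  thus ?thesis by (simp add: ev_def left_diff_distrib sum_subtractf)
qed

lemma ev_axis:
  assumes fe: "field_embedding emb"
  shows "ev emb \<alpha> (axis j 1) = vec_nth \<alpha> j"
proof -
  have "emb (vec_nth (axis j 1) l) * vec_nth \<alpha> l = (if l = j then vec_nth \<alpha> l else 0)" for l
    using fe field_embedding_zero[OF fe] by (simp add: axis_def field_embedding_def)
  thus ?thesis by (simp add: ev_def)
qed

lemma vector_space_fq_scale:
  assumes "field_embedding emb"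
  shows "vector_space (fq_scale emb)"
  using assms by unfold_locales (auto simp: fq_scale_def field_embedding_def algebra_simps)

text \<open>Repeated coordinates collapse in a set, which is why independence comes with
  injectivity; a repetition shows up here as the kernel vector \<open>axis i 1 - axis j 1\<close>.
  In this form the dependent \<alpha> are a union of hyperplanes, one for each nonzero c.\<close>

lemma fq_lin_indep_coords_iff:
  fixes emb :: "'b::field \<Rightarrow> 'a::field" and \<alpha> :: "'a^'n"
  assumes fe: "field_embedding emb"
  shows "fq_lin_indep_coords emb \<alpha> \<longleftrightarrow> (\<forall>c. ev emb \<alpha> c = 0 \<longrightarrow> c = 0)"
proof -
  interpret V: vector_space "fq_scale emb" by (rule vector_space_fq_scale[OF fe])
  let ?a = "\<lambda>j. vec_nth \<alpha> j"
  have sum_range: "(\<Sum>x\<in>range ?a. fq_scale emb (f x) x) = ev emb \<alpha> (\<chi> j. f (?a j))" if "inj ?a" for f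
    using that by (simp add: sum.reindex ev_def fq_scale_def)
  show ?thesis
  proof
    assume ind: "fq_lin_indep_coords emb \<alpha>"
    hence inj: "inj ?a" and nd: "V.independent (range ?a)" by (auto simp: fq_lin_indep_coords_def)
    show "\<forall>c. ev emb \<alpha> c = 0 \<longrightarrow> c = 0"
    proof (intro allI impI)
      fix c assume c: "ev emb \<alpha> c = 0"
      let ?f = "\<lambda>x. vec_nth c (inv_into UNIV ?a x)"
      have "(\<chi> j. ?f (?a j)) = c" by (simp add: inv_into_f_f[OF inj])
      hence "(\<Sum>x\<in>range ?a. fq_scale emb (?f x) x) = 0" using sum_range[OF inj, of ?f] c by simp
      hence f0: "?f (?a j) = 0" for j
        using V.independentD[OF nd _ subset_refl, of ?f "?a j"] by simp
      have "vec_nth c j = 0" for j using f0[of j] inv_into_f_f[OF inj, of j] by simp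
      thus "c = 0" by (simp add: Finite_Cartesian_Product.vec_eq_iff)
    qed
  next
    assume c: "\<forall>c. ev emb \<alpha> c = 0 \<longrightarrow> c = 0"
    have inj: "inj ?a"
    proof (rule injI, rule ccontr)
      fix i j assume ij: "?a i = ?a j" "i \<noteq> j"
      hence "ev emb \<alpha> (axis i 1 - axis j 1) = 0" by (simp add: ev_diff_right[OF fe] ev_axis[OF fe])
      hence "axis i 1 - axis j (1 :: 'b) = 0" by (rule c[rule_format])
      hence "vec_nth (axis i 1 - axis j (1 :: 'b)) i = vec_nth 0 i" by (rule arg_cong)
      thus False using ij(2) by (simp add: axis_def)
    qed
    moreover have "V.independent (range ?a)"
    proof (rule V.independent_if_scalars_zero)
      fix f x assume "(\<Sum>x\<in>range ?a. fq_scale emb (f x) x) = 0" and x: "x \<in> range ?a"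
      hence "ev emb \<alpha> (\<chi> j. f (?a j)) = 0" by (simp only: sum_range[OF inj])
      hence "(\<chi> j. f (?a j)) = 0" by (rule c[rule_format])
      hence "f (?a j) = 0" for j by (simp add: Finite_Cartesian_Product.vec_eq_iff)
      thus "f x = 0" using x by auto
    qed simp
    ultimately show "fq_lin_indep_coords emb \<alpha>" by (simp add: fq_lin_indep_coords_def)
  qed
qed

text \<open>For c with a nonzero entry at j, the point \<open>axis j 1\<close> lies off the
  hyperplane of c, so every line through it meets that hyperplane at most once. The bound sums this
  over the vectors c.\<close>

lemma card_not_lin_indep_le:
  fixes emb :: "'b::{finite,field} \<Rightarrow> 'a::{finite,field}"
  assumes fe: "field_embedding emb"
  shows "card {\<alpha> :: 'a^'n. \<not> fq_lin_indep_coords emb \<alpha>} * (CARD('a) - 1)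
           \<le> CARD('b) ^ CARD('n) * CARD('a) ^ CARD('n)"
proof -
  let ?Z = "\<lambda>c. {\<alpha> :: 'a^'n. ev emb \<alpha> c = 0}"
  have Z: "card (?Z c) * (CARD('a) - 1) \<le> CARD('a) ^ CARD('n)" if c: "c \<noteq> 0" for c :: "'b^'n"
  proof -
    obtain j where j: "vec_nth c j \<noteq> 0" using c by (auto simp: Finite_Cartesian_Product.vec_eq_iff)
    have a0: "ev emb (axis j 1) c \<noteq> 0"
      using j by (simp add: ev_def axis_def if_distrib[where f="\<lambda>x. _ * x"] field_embedding_eq_0_iff[OF fe] cong: if_cong)
    have "card {t. axis j 1 + t *s \<beta> \<in> ?Z c} \<le> 1" for \<beta>
    proof -
      have "t = t'" if "t \<in> {t. axis j 1 + t *s \<beta> \<in> ?Z c}" "t' \<in> {t. axis j 1 + t *s \<beta> \<in> ?Z c}" for t t'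
      proof -
        have *: "ev emb (axis j 1) c + t * ev emb \<beta> c = 0" "ev emb (axis j 1) c + t' * ev emb \<beta> c = 0"
          using that by (simp_all add: ev_add_smult)
        hence "t * ev emb \<beta> c = t' * ev emb \<beta> c" by (metis add_left_cancel)
        moreover have "ev emb \<beta> c \<noteq> 0" using * a0 by auto
        ultimately show ?thesis by simp
      qed
      thus ?thesis by (subst card_le_Suc0_iff_eq[unfolded One_nat_def[symmetric]]) auto
    qed
    from card_le_by_lines[OF this] show ?thesis by simp
  qed
  have "{\<alpha> :: 'a^'n. \<not> fq_lin_indep_coords emb \<alpha>} = (\<Union>c\<in>UNIV - {0}. ?Z c)"
    by (auto simp: fq_lin_indep_coords_iff[OF fe])
  hence "card {\<alpha> :: 'a^'n. \<not> fq_lin_indep_coords emb \<alpha>} \<le> (\<Sum>c\<in>UNIV - {0}. card (?Z c))"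
    by (simp add: card_UN_le)
  hence "card {\<alpha> :: 'a^'n. \<not> fq_lin_indep_coords emb \<alpha>} * (CARD('a) - 1) \<le> (\<Sum>c\<in>UNIV - {0}. card (?Z c) * (CARD('a) - 1))"
    unfolding sum_distrib_right[symmetric] by (rule mult_le_mono1)
  also have "\<dots> \<le> (\<Sum>c\<in>UNIV - {0 :: 'b^'n}. CARD('a) ^ CARD('n))" by (intro sum_mono Z) auto
  also have "\<dots> \<le> (\<Sum>c\<in>(UNIV :: ('b^'n) set). CARD('a) ^ CARD('n))" by (intro sum_mono2) auto
  also have "\<dots> = CARD('b) ^ CARD('n) * CARD('a) ^ CARD('n)" by simp
  finally show ?thesis .
qed

lemma card_span_le:
  fixes emb :: "'b::{finite,field} \<Rightarrow> 'a::field"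
  assumes fe: "field_embedding emb" and fin: "finite S"
  shows "card (module.span (fq_scale emb) S) \<le> CARD('b) ^ fq_dim emb S"
proof -
  interpret V: vector_space "fq_scale emb" by (rule vector_space_fq_scale[OF fe])
  obtain B where B: "B \<subseteq> S" "V.independent B" "S \<subseteq> V.span B" "card B = V.dim S"
    using V.basis_exists by blast
  have finB: "finite B" using B(1) fin by (rule finite_subset)
  have "V.span S = V.span B"
    using V.span_mono[OF B(1)] V.span_minimal[OF B(3) V.subspace_span] by (rule equalityI[rotated])
  also have "\<dots> \<subseteq> (\<lambda>u. \<Sum>v\<in>B. fq_scale emb (u v) v) ` (B \<rightarrow>\<^sub>E UNIV)"
  proof
    fix x assume "x \<in> V.span B"
    then obtain u where "x = (\<Sum>v\<in>B. fq_scale emb (u v) v)" unfolding V.span_finite[OF finB] by auto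
    hence "x = (\<Sum>v\<in>B. fq_scale emb (restrict u B v) v)" by simp
    thus "x \<in> (\<lambda>u. \<Sum>v\<in>B. fq_scale emb (u v) v) ` (B \<rightarrow>\<^sub>E UNIV)"
      by (rule image_eqI[where x = "restrict u B"]) simp
  qed
  finally have sub: "V.span S \<subseteq> (\<lambda>u. \<Sum>v\<in>B. fq_scale emb (u v) v) ` (B \<rightarrow>\<^sub>E UNIV)" .
  have finE: "finite (B \<rightarrow>\<^sub>E (UNIV :: 'b set))" using finB by (intro finite_PiE) auto
  have "card (V.span S) \<le> card (B \<rightarrow>\<^sub>E (UNIV :: 'b set))" by (rule surj_card_le[OF finE sub])
  also have "\<dots> = CARD('b) ^ fq_dim emb S" using finB B(4) by (simp add: card_funcsetE fq_dim_def)
  finally show "card (V.span S) \<le> CARD('b) ^ fq_dim emb S" .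
qed

text \<open>A q-polynomial f of q-degree below k satisfies f(ev \<alpha> w) = ev v w for the codeword v, and its
  fibres have at most q^(k-1) elements; so the q^n vectors w yield at least q^(n-k+1) values in the
  span of the coordinates of v.\<close>
lemma is_MRD_gabidulin:
  fixes emb :: "'b::{finite,field} \<Rightarrow> 'a::{finite,field}" and \<alpha> :: "'a^'n"
  assumes fe: "field_embedding emb" and q: "CARD('b) = q" and k: "1 \<le> k" "k \<le> CARD('n)"
    and ind: "fq_lin_indep_coords emb \<alpha>"
  shows "is_MRD emb k (gabidulin_code q k \<alpha>)"
  unfolding is_MRD_def
proof (intro ballI impI)
  interpret V: vector_space "fq_scale emb" by (rule vector_space_fq_scale[OF fe])
  have q2: "2 \<le> q" using CARD_field_ge_2[where 'a = 'b] q by simp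
  fix v assume "v \<in> gabidulin_code q k \<alpha>" and v0: "v \<noteq> 0"
  then obtain c where v: "v = (\<chi> j. \<Sum>i<k. c i * vec_nth \<alpha> j ^ (q ^ i))"
    by (auto simp: gabidulin_code_def gab_gen_def)
  define F where "F = (\<Sum>i<k. monom (c i) (q ^ i))"
  have polyF: "poly F (ev emb \<alpha> w) = ev emb v w" for w
  proof -
    have "poly F (ev emb \<alpha> w) = (\<Sum>i<k. \<Sum>j\<in>UNIV. c i * (emb (vec_nth w j) * vec_nth \<alpha> j ^ (q ^ i)))"
      by (simp add: F_def poly_sum poly_monom ev_power[OF fe q] sum_distrib_left)
    also have "\<dots> = (\<Sum>j\<in>UNIV. \<Sum>i<k. c i * (emb (vec_nth w j) * vec_nth \<alpha> j ^ (q ^ i)))" by (rule sum.swap)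
    also have "\<dots> = ev emb v w" by (simp add: ev_def v sum_distrib_left mult_ac)
    finally show ?thesis .
  qed
  have "\<exists>i<k. c i \<noteq> 0"
  proof (rule ccontr)
    assume "\<not> ?thesis"
    hence "v = 0" by (simp add: v Finite_Cartesian_Product.vec_eq_iff)
    with v0 show False by contradiction
  qed
  then obtain i where i: "i < k" "c i \<noteq> 0" by blast
  have fibre: "card {w. ev emb v w = y} \<le> q ^ (k - 1)" for y
  proof -
    let ?P = "F - [:y:]"
    \<comment> \<open>As q \<ge> 2, the exponents q^l are distinct and positive, so the term of c i
      cancels neither against another one nor against y.\<close>
    have "coeff F (q ^ i) = (\<Sum>l<k. if l = i then c l else 0)"
      unfolding F_def coeff_sum using q2 by (intro sum.cong) (auto simp: power_inject_exp)
    hence "coeff F (q ^ i) = c i" using i by simp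
    moreover have "coeff [:y:] (q ^ i) = 0" using q2 by (simp add: coeff_pCons split: nat.split)
    ultimately have "coeff ?P (q ^ i) \<noteq> 0" using i by simp
    hence P0: "?P \<noteq> 0" by auto
    have "degree F \<le> q ^ (k - 1)" unfolding F_def
    proof (rule degree_sum_le)
      fix l assume "l \<in> {..<k}"
      hence "q ^ l \<le> q ^ (k - 1)" using q2 by (intro power_increasing) auto
      thus "degree (monom (c l) (q ^ l)) \<le> q ^ (k - 1)" using degree_monom_le order.trans by blast
    qed simp
    hence degP: "degree ?P \<le> q ^ (k - 1)" by (intro degree_diff_le) auto
    have "inj_on (ev emb \<alpha>) {w. ev emb v w = y}"
    proof (rule inj_onI)
      fix w w' assume "ev emb \<alpha> w = ev emb \<alpha> w'"
      hence "ev emb \<alpha> (w - w') = 0" by (simp add: ev_diff_right[OF fe])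
      hence "w - w' = 0" using ind fq_lin_indep_coords_iff[OF fe] by blast
      thus "w = w'" by simp
    qed
    hence "card {w. ev emb v w = y} \<le> card {x. poly ?P x = 0}"
      by (rule card_inj_on_le) (auto simp: polyF poly_roots_finite[OF P0])
    also have "\<dots> \<le> degree ?P" by (rule card_poly_roots_bound[OF P0])
    also note degP
    finally show ?thesis .
  qed
  let ?S = "range (\<lambda>j. vec_nth v j)"
  have in_span: "ev emb v w \<in> V.span ?S" for w
    unfolding ev_def fq_scale_def[of emb, symmetric]
    by (intro V.span_sum V.span_scale V.span_base) auto
  have "UNIV \<subseteq> (\<Union>y\<in>V.span ?S. {w :: 'b^'n. ev emb v w = y})" using in_span by auto
  hence "CARD('b^'n) \<le> card (\<Union>y\<in>V.span ?S. {w :: 'b^'n. ev emb v w = y})"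
    by (intro card_mono) auto
  also have "\<dots> \<le> (\<Sum>y\<in>V.span ?S. card {w :: 'b^'n. ev emb v w = y})" by (intro card_UN_le) auto
  also have "\<dots> \<le> (\<Sum>y\<in>V.span ?S. q ^ (k - 1))" by (intro sum_mono fibre)
  also have "\<dots> = card (V.span ?S) * q ^ (k - 1)" by simp
  also have "\<dots> \<le> q ^ fq_dim emb ?S * q ^ (k - 1)"
    using card_span_le[OF fe, of ?S] q by (intro mult_le_mono1) auto
  finally have "q ^ CARD('n) \<le> q ^ (fq_dim emb ?S + (k - 1))" using q by (simp add: power_add)
  hence "CARD('n) \<le> fq_dim emb ?S + (k - 1)" using q2 by (simp add: power_increasing_iff)
  thus "CARD('n) - k + 1 \<le> fq_dim emb ?S" using k by linarith
qed

section \<open>Counting kernel patterns\<close>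

lemma subspace_span_of_few:
  fixes X :: "('b::field^'n) set"
  assumes X: "vec.subspace X" and dim: "vec.dim X < k"
  shows "\<exists>e. vec.span (e ` {1..<k}) = X"
proof -
  obtain B where B: "B \<subseteq> X" "vec.independent B" "X \<subseteq> vec.span B" "card B = vec.dim X"
    using vec.basis_exists by blast
  have finB: "finite B" using B(2) by (rule vec.finiteI_independent)
  have "card B \<le> card {1..<k}" using B(4) dim by simp
  then obtain \<phi> where \<phi>: "\<phi> ` B \<subseteq> {1..<k}" "inj_on \<phi> B"
    using card_le_inj[OF finB, of "{1..<k}"] by auto
  define e where "e j = (if j \<in> \<phi> ` B then inv_into B \<phi> j else 0)" for j
  have "b \<in> e ` {1..<k}" if "b \<in> B" for b
    using \<phi> that by (intro image_eqI[of _ _ "\<phi> b"]) (auto simp: e_def)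
  hence "B \<subseteq> e ` {1..<k}" by blast
  hence "X \<subseteq> vec.span (e ` {1..<k})" using B(3) vec.span_mono by blast
  moreover have "e j \<in> X" for j
    using B(1) vec.subspace_0[OF X] inv_into_into[of j \<phi> B] by (auto simp: e_def)
  hence "vec.span (e ` {1..<k}) \<subseteq> X" using X by (intro vec.span_minimal) auto
  ultimately show ?thesis by blast
qed

text \<open>Decoding is total: an index marked by several blocks receives the sum of their spans,
  and an unmarked index the zero space. Zero spaces therefore need no block, in accordance with the
  definition of the order.\<close>

definition pattern_of_code :: "nat \<Rightarrow> nat \<Rightarrow> (nat \<Rightarrow> 'n) \<Rightarrow> (nat \<Rightarrow> nat \<Rightarrow> 'b::field^'n) \<Rightarrow> nat \<Rightarrow> ('b^'n) set" where
  "pattern_of_code r k \<iota> c i = vec.span (\<Union>s\<in>{s. s < r \<and> vec_nth (c s 0) (\<iota> i) \<noteq> 0}. c s ` {1..<k})"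

text \<open>Of the k vectors coding one of the at most r nonzero spaces, k - 1 span it (genericity bounds
  its dimension by k - 1) and the remaining one marks the indices at which it occurs.\<close>
lemma pattern_code_exists:
  fixes V :: "nat \<Rightarrow> ('b::field^'n) set"
  assumes kp: "kernel_pattern k V" and gen: "generic_kp k V" and ord: "kp_order k V \<le> r"
    and \<iota>: "inj_on \<iota> {..<k}" and k: "1 \<le> k"
  shows "\<exists>c \<in> {..<r} \<rightarrow>\<^sub>E ({..<k} \<rightarrow>\<^sub>E UNIV). \<forall>i<k. pattern_of_code r k \<iota> c i = V i"
proof -
  have subV: "vec.subspace (V i)" if "i < k" for i using kp that by (simp add: kernel_pattern_def)
  have dimV: "vec.dim (V i) < k" if "i < k" for i
    using gen[unfolded generic_kp_def, THEN spec[of _ "{i}"]] that by auto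
  define D where "D = {V i | i. i < k \<and> V i \<noteq> {0}}"
  have "D \<subseteq> V ` {..<k}" by (auto simp: D_def)
  hence finD: "finite D" using finite_subset by blast
  have "card D \<le> card {..<r}" using ord by (simp add: D_def kp_order_def)
  then obtain g where g: "g ` D \<subseteq> {..<r}" "inj_on g D"
    using card_le_inj[OF finD, of "{..<r}"] by auto
  have "\<exists>e. vec.span (e ` {1..<k}) = X" if X: "X \<in> D" for X
  proof -
    obtain i where i: "i < k" "X = V i" using X by (auto simp: D_def)
    show ?thesis unfolding i(2) by (rule subspace_span_of_few[OF subV[OF i(1)] dimV[OF i(1)]])
  qed
  then obtain e where e: "\<And>X. X \<in> D \<Longrightarrow> vec.span (e X ` {1..<k}) = X" by metis
  \<comment> \<open>Because \<iota> is injective on the k indices, one vector of F_q^n can record a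
    subset of them.\<close>
  define mark :: "nat \<Rightarrow> 'b^'n" where
    "mark s = (\<chi> a. if \<exists>i<k. a = \<iota> i \<and> V i \<in> D \<and> g (V i) = s then 1 else 0)" for s
  define c where "c = (\<lambda>s\<in>{..<r}. \<lambda>j\<in>{..<k}. if j = 0 then mark s else e (inv_into D g s) j)"
  have "c \<in> {..<r} \<rightarrow>\<^sub>E ({..<k} \<rightarrow>\<^sub>E UNIV)" by (auto simp: c_def)
  moreover have "pattern_of_code r k \<iota> c i = V i" if i: "i < k" for i
  proof -
    have mark: "vec_nth (mark s) (\<iota> i) \<noteq> 0 \<longleftrightarrow> V i \<in> D \<and> g (V i) = s" for s
      using i inj_on_eq_iff[OF \<iota>] by (auto simp: mark_def)
    have set_eq: "{s. s < r \<and> vec_nth (c s 0) (\<iota> i) \<noteq> 0} = (if V i \<in> D then {g (V i)} else {})"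
      using mark g k by (auto simp: c_def)
    show ?thesis
    proof (cases "V i \<in> D")
      case True
      hence "g (V i) < r" "inv_into D g (g (V i)) = V i" using g by (auto intro: inv_into_f_f)
      hence "c (g (V i)) ` {1..<k} = e (V i) ` {1..<k}" by (intro image_cong) (auto simp: c_def)
      thus ?thesis using True e by (simp add: pattern_of_code_def set_eq)
    next
      case False
      hence "V i = {0}" using i by (auto simp: D_def)
      thus ?thesis using False by (simp add: pattern_of_code_def set_eq)
    qed
  qed
  ultimately show ?thesis by blast
qed

lemma card_not_GKP_le:
  fixes emb :: "'b::{finite,field} \<Rightarrow> 'a::{finite,field}"
  assumes fe: "field_embedding emb" and q: "CARD('b) = q"
    and k: "1 \<le> k" "k \<le> CARD('n)"
    and Q: "2 * ((k + 1) * k * q ^ k) + 1 < CARD('a)"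
  shows "card {\<alpha> :: 'a^'n. fq_lin_indep_coords emb \<alpha> \<and> \<not> is_GKP emb q k l \<alpha>} * (CARD('a) - 1)
     \<le> q ^ (CARD('n) * k * min l k) * (k * q ^ k * CARD('a) ^ CARD('n))"
proof -
  have q2: "2 \<le> q" using CARD_field_ge_2[where 'a = 'b] q by simp
  obtain \<iota> :: "nat \<Rightarrow> 'n" where \<iota>: "inj_on \<iota> {..<k}"
    using card_le_inj[of "{..<k}" "UNIV :: 'n set"] k by auto
  define r where "r = min l k"
  define codes where "codes = {..<r} \<rightarrow>\<^sub>E ({..<k} \<rightarrow>\<^sub>E (UNIV :: ('b^'n) set))"
  have fin: "finite codes" unfolding codes_def by (intro finite_PiE) auto
  have card_codes: "card codes = q ^ (CARD('n) * k * min l k)"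
    by (simp add: codes_def card_funcsetE q r_def power_mult)
  define bad where "bad c = {\<alpha> :: 'a^'n. kernel_pattern k (pattern_of_code r k \<iota> c) \<and> generic_kp k (pattern_of_code r k \<iota> c)
     \<and> \<not> attains emb k (gab_gen q \<alpha>) (pattern_of_code r k \<iota> c)}" for c
  have bad: "card (bad c) * (CARD('a) - 1) \<le> k * q ^ k * CARD('a) ^ CARD('n)" for c
  proof (cases "kernel_pattern k (pattern_of_code r k \<iota> c) \<and> generic_kp k (pattern_of_code r k \<iota> c)")
    case True
    hence "bad c = {\<alpha> :: 'a^'n. \<not> attains emb k (gab_gen q \<alpha>) (pattern_of_code r k \<iota> c)}"
      by (simp add: bad_def)
    thus ?thesis using card_not_attains_le[OF fe q q2 _ _ k Q] True by simp
  next
    case False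
    hence "bad c = {}" by (auto simp: bad_def)
    thus ?thesis by simp
  qed
  have "{\<alpha> :: 'a^'n. fq_lin_indep_coords emb \<alpha> \<and> \<not> is_GKP emb q k l \<alpha>} \<subseteq> (\<Union>c\<in>codes. bad c)"
  proof clarify
    fix \<alpha> :: "'a^'n" assume "fq_lin_indep_coords emb \<alpha>" "\<not> is_GKP emb q k l \<alpha>"
    with is_MRD_gabidulin[OF fe q k] obtain V where V: "kernel_pattern k V" "generic_kp k V"
      "kp_order k V \<le> l" "\<not> attains emb k (gab_gen q \<alpha>) V" unfolding is_GKP_def by blast
    \<comment> \<open>Only k spaces occur, so the order never exceeds k; this is the origin of
      \<open>min l k\<close>.\<close>
    have "{V i | i. i < k \<and> V i \<noteq> {0}} \<subseteq> V ` {..<k}" by auto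
    hence "kp_order k V \<le> card (V ` {..<k})" unfolding kp_order_def by (intro card_mono) auto
    also have "\<dots> \<le> k" using card_image_le[of "{..<k}" V] by simp
    finally have "kp_order k V \<le> r" using V(3) by (simp add: r_def)
    from pattern_code_exists[OF V(1,2) this \<iota> k(1)] obtain c where
      c: "c \<in> codes" "\<And>i. i < k \<Longrightarrow> pattern_of_code r k \<iota> c i = V i" unfolding codes_def by blast
    \<comment> \<open>Being a kernel pattern, genericity and attainment all read a pattern only at
      indices below k, where the decoded one agrees with V.\<close>
    have "kernel_pattern k (pattern_of_code r k \<iota> c)" using V(1) c(2) by (simp add: kernel_pattern_def)
    moreover have "generic_kp k (pattern_of_code r k \<iota> c)"
      unfolding generic_kp_def
    proof (intro allI impI)
      fix \<Omega> assume \<Omega>: "\<Omega> \<subseteq> {..<k} \<and> \<Omega> \<noteq> {}"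
      have "(\<Inter>i\<in>\<Omega>. pattern_of_code r k \<iota> c i) = (\<Inter>i\<in>\<Omega>. V i)" using \<Omega> c(2) by (intro INF_cong) auto
      thus "vec.dim (\<Inter>i\<in>\<Omega>. pattern_of_code r k \<iota> c i) \<le> k - card \<Omega>" using V(2) \<Omega> by (simp add: generic_kp_def)
    qed
    moreover have "\<not> attains emb k (gab_gen q \<alpha>) (pattern_of_code r k \<iota> c)"
      using V(4) c(2) by (simp add: attains_def)
    ultimately show "\<alpha> \<in> (\<Union>c\<in>codes. bad c)" using c(1) by (auto simp: bad_def)
  qed
  hence "card {\<alpha> :: 'a^'n. fq_lin_indep_coords emb \<alpha> \<and> \<not> is_GKP emb q k l \<alpha>} \<le> card (\<Union>c\<in>codes. bad c)"
    by (intro card_mono) auto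
  also have "\<dots> \<le> (\<Sum>c\<in>codes. card (bad c))" by (rule card_UN_le[OF fin])
  finally have "card {\<alpha> :: 'a^'n. fq_lin_indep_coords emb \<alpha> \<and> \<not> is_GKP emb q k l \<alpha>} * (CARD('a) - 1)
    \<le> (\<Sum>c\<in>codes. card (bad c)) * (CARD('a) - 1)" by (rule mult_le_mono1)
  also have "\<dots> = (\<Sum>c\<in>codes. card (bad c) * (CARD('a) - 1))" by (rule sum_distrib_right)
  also have "\<dots> \<le> (\<Sum>c\<in>codes. k * q ^ k * CARD('a) ^ CARD('n))" by (intro sum_mono bad)
  also have "\<dots> = q ^ (CARD('n) * k * min l k) * (k * q ^ k * CARD('a) ^ CARD('n))" by (simp only: sum_constant card_codes of_nat_id)
  finally show ?thesis .
qed

text \<open>The constant 3 is 2 times 3/2: replacing q^m - 1 by q^m in the denominator costs at most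
  a factor 2, and conditioning on independent coordinates at most 3/2, since these make up at least
  two thirds of all points once the bound is nontrivial.\<close>

theorem mainTheorem8:
  fixes emb :: "'b::{finite,field} \<Rightarrow> 'a::{finite,field}"
    and q m k l :: nat
  assumes "field_embedding emb"
    and "CARD('b) = q"
    and "CARD('a) = q ^ m"
    and "1 \<le> k" and "k \<le> CARD('n::finite)" and "CARD('n) \<le> m"
    and "1 \<le> l"
  shows "let S = {\<alpha> :: 'a^'n. fq_lin_indep_coords emb \<alpha>} in
    real (card {\<alpha>\<in>S. is_GKP emb q k l \<alpha>}) / real (card S)
      \<ge> 1 - 3 * real k * real q powr (real (CARD('n) * k * min l k + k) - real m)"
proof -
  define N where "N = CARD('n)"
  define Q where "Q = CARD('a)"
  define P where "P = q ^ (N * k * min l k)"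
  define S where "S = {\<alpha> :: 'a^'n. fq_lin_indep_coords emb \<alpha>}"
  define bad where "bad = {\<alpha> \<in> S. \<not> is_GKP emb q k l \<alpha>}"
  have q2: "2 \<le> q" using CARD_field_ge_2[where 'a = 'b] assms(2) by simp
  have powr: "real q powr (real (N * k * min l k + k) - real m) = real (P * q ^ k) / real Q"
    using q2 assms(3) by (simp add: P_def Q_def powr_diff powr_realpow power_add flip: of_nat_add)
  have "real (card {\<alpha>\<in>S. is_GKP emb q k l \<alpha>}) / real (card S) \<ge> 1 - 3 * real k * (real (P * q ^ k) / real Q)"
  proof (cases "3 * k * (P * q ^ k) < Q")
    case False
    have "Q > 0" unfolding Q_def by (simp add: card_gt_0_iff)
    moreover have "real Q \<le> real (3 * k * (P * q ^ k))" using False by (simp only: of_nat_le_iff not_less)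
    ultimately have "1 \<le> real (3 * k * (P * q ^ k)) / real Q" by (simp only: le_divide_eq_1_pos of_nat_0_less_iff)
    also have "\<dots> = 3 * real k * (real (P * q ^ k) / real Q)" by simp
    finally have "1 \<le> 3 * real k * (real (P * q ^ k) / real Q)" .
    moreover have "0 \<le> real (card {\<alpha>\<in>S. is_GKP emb q k l \<alpha>}) / real (card S)" by simp
    ultimately show ?thesis by linarith
  next
    case True
    have "1 * k * 1 \<le> N * k * min l k" using assms(4,5,7) by (intro mult_mono) (auto simp: N_def)
    hence "q ^ k \<le> P" unfolding P_def using q2 by (intro power_increasing) simp_all
    moreover have "2 ^ k \<le> q ^ k" using q2 by (intro power_mono) simp_all
    ultimately have "2 ^ k \<le> P" by (rule order.trans[rotated])
    \<comment> \<open>This makes the field size demanded by the existence argument a consequence of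
      the case assumption.\<close>
    hence Pk: "k + 1 \<le> P" using less_exp[of k] by linarith
    have "2 * ((k + 1) * k * q ^ k) + 1 \<le> 3 * ((k + 1) * k * q ^ k)" using assms(4) q2 by simp
    also have "\<dots> \<le> 3 * (P * k * q ^ k)" by (intro mult_le_mono Pk order.refl)
    also have "\<dots> = 3 * k * (P * q ^ k)" by simp
    finally have Qbig: "2 * ((k + 1) * k * q ^ k) + 1 < CARD('a)" using True by (simp add: Q_def)
    have bad: "card bad * (Q - 1) \<le> P * (k * q ^ k * Q ^ N)"
      using card_not_GKP_le[OF assms(1,2,4,5) Qbig, of l] by (simp add: bad_def S_def P_def Q_def N_def)
    have "1 * N * 1 \<le> k * N * min l k" using assms(4,7) by (intro mult_mono) auto
    hence "q ^ N \<le> P" unfolding P_def using q2 by (intro power_increasing) (simp_all add: mult_ac)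
    hence "1 * (q ^ N * 1) \<le> k * (P * q ^ k)" using assms(4) q2 by (intro mult_le_mono) simp_all
    \<comment> \<open>The share of dependent points is at most q^n / (q^m - 1), hence at most one
      third.\<close>
    hence qN: "3 * q ^ N \<le> Q - 1" using True by linarith
    have compl: "card (- S) * (Q - 1) \<le> q ^ N * Q ^ N"
      using card_not_lin_indep_le[OF assms(1), where 'n = 'n] assms(2)
      by (simp add: S_def Q_def N_def Collect_neg_eq)
    have "q ^ N * (3 * card (- S)) \<le> card (- S) * (Q - 1)" using mult_le_mono2[OF qN, of "card (- S)"] by (simp only: mult_ac)
    also note compl
    finally have "3 * card (- S) \<le> Q ^ N" using q2 by simp
    moreover have "card S + card (- S) = Q ^ N"
      using card_Un_disjoint[of S "- S"] by (simp add: Compl_partition Q_def N_def)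
    ultimately have cS: "2 * Q ^ N \<le> 3 * card S" by linarith
    have Q2: "2 \<le> Q" using CARD_field_ge_2[where 'a = 'a] by (simp add: Q_def)
    hence "0 < 2 * Q ^ N" by simp
    with cS have cS0: "card S > 0" by linarith
    have "card bad * Q \<le> card bad * (2 * (Q - 1))" using Q2 by (intro mult_le_mono2) simp
    also have "\<dots> \<le> P * k * q ^ k * (2 * Q ^ N)" using bad by simp
    also have "\<dots> \<le> P * k * q ^ k * (3 * card S)" using cS by (intro mult_le_mono2)
    finally have "card bad * Q \<le> 3 * k * (P * q ^ k) * card S" by (simp add: mult_ac)
    hence "real (card bad) * real Q \<le> 3 * real k * real (P * q ^ k) * real (card S)"
      by (metis (no_types, lifting) of_nat_le_iff of_nat_mult of_nat_numeral)
    hence ratio: "real (card bad) / real (card S) \<le> 3 * real k * (real (P * q ^ k) / real Q)"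
      using cS0 Q2 by (simp add: field_simps)
    have "card {\<alpha>\<in>S. is_GKP emb q k l \<alpha>} + card bad = card ({\<alpha>\<in>S. is_GKP emb q k l \<alpha>} \<union> bad)"
      by (rule card_Un_disjoint[symmetric]) (auto simp: bad_def)
    also have "{\<alpha>\<in>S. is_GKP emb q k l \<alpha>} \<union> bad = S" by (auto simp: bad_def)
    finally have "real (card {\<alpha>\<in>S. is_GKP emb q k l \<alpha>}) = real (card S) - real (card bad)" by linarith
    moreover have "S \<noteq> {}" using cS0 by auto
    ultimately have "real (card {\<alpha>\<in>S. is_GKP emb q k l \<alpha>}) / real (card S) = 1 - real (card bad) / real (card S)"
      by (simp add: diff_divide_distrib)
    with ratio show ?thesis by linarith
  qed
  thus ?thesis unfolding Let_def S_def[symmetric] N_def[symmetric] powr .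
qed

end
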